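(* Let $r_n\le 1.405$ for $2\le n\le N$, let $\gamma=1/200$, and suppose the time-step sizes satisfy $$\tau_n\leq \min\left\{\frac{1+2 r_n+r_{n-1}\left(1+4 r_n+3 r_n^2\right)}{(1+r_n)(1+r_{n-1}+r_nr_{n-1})},\,2\gamma\right\},\qquad 1\le n\le N.$$ Then the solution $(u^n)_{n=0}^N$ of the variable-step BDF3 scheme $D_3u^n-\varepsilon^2\Delta u^n+f(u^n)=0$, $1\le n\le N$, with $u^0=u_0$, satisfies the energy dissipation law $$E(u^n)\le E(u^0),\qquad 1\le n\le N.$$
   Context: Let $0=t_0<t_1<\dots<t_N=T$, $\tau_k=t_k-t_{k-1}$ for $1\le k\le N$, $r_k=\tau_k/\tau_{k-1}$ for $k\ge 2$, with the convention $r_1=r_0=0$ in the displayed step-size condition when $n=1,2$. For a sequence $(v^n)_{n=0}^N$ put $\nabla_\tau v^n=v^n-v^{n-1}$. The variable-step BDF3 operator is $D_3v^n=\sum_{k=1}^n b_{n-k}^{(n)}\nabla_\tau v^k$, where $b_0^{(1)}=1/\tau_1$, $b_0^{(2)}=\frac{1+2r_2}{\tau_2(1+r_2)}$, $b_1^{(2)}=-\frac{r_2^2}{\tau_2(1+r_2)}$, and for $n\ge 3$ $$b_0^{(n)}=\frac{(1+r_{n-1})\left[1+2 r_n+r_{n-1}(1+4 r_n+3 r_n^2)\right]}{\tau_n(1+r_n)(1+r_{n-1})(1+r_{n-1}+r_nr_{n-1})},$$ $$b_1^{(n)}=-\frac{r_n^2\left[(1+2r_{n-1}+r_nr_{n-1})^2-r_{n-1}(1+r_{n-1})\right]}{\tau_n(1+r_n)(1+r_{n-1})(1+r_{n-1}+r_nr_{n-1})},$$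 $$b_2^{(n)}=\frac{r_n^2r_{n-1}^3(1+r_n)^2}{\tau_n(1+r_n)(1+r_{n-1})(1+r_{n-1}+r_nr_{n-1})},\qquad b_j^{(n)}=0\ (j\ge 3).$$ Here $\varepsilon>0$, $f(u)=u^3-u$, and $\Omega\subset\mathbb{R}^d$ is a bounded periodic cell with periodic boundary conditions. Let $V$ be the space of periodic functions in $H^1(\Omega)\cap L^4(\Omega)$, $u_0\in V$, $u^n\in V$; the scheme is understood weakly: $(D_3u^n,v)+\varepsilon^2(\nabla u^n,\nabla v)+(f(u^n),v)=0$ for all $v\in V$, with $(\cdot,\cdot)$, $\|\cdot\|$ the $L^2(\Omega)$ inner product and norm. The discrete energy is $E(v)=\frac{\varepsilon^2}{2}\|\nabla v\|^2+\frac14\|v^2-1\|^2$. *)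

theory Defs
  imports "HOL-Analysis.Analysis"
begin

section \<open>Time mesh and the variable-step BDF3 operator\<close>

definition tau :: "(nat \<Rightarrow> real) \<Rightarrow> nat \<Rightarrow> real" where
  "tau t k = t k - t (k - 1)"

text \<open>The values at \<open>k = 0, 1\<close> are the convention \<open>r\<^sub>0 = r\<^sub>1 = 0\<close>. They enter only the
  step-size condition, since the kernels below use \<open>r\<^sub>k\<close> with \<open>k \<ge> 2\<close> only.\<close>

definition ratio :: "(nat \<Rightarrow> real) \<Rightarrow> nat \<Rightarrow> real" where
  "ratio t k = (if 2 \<le> k then tau t k / tau t (k - 1) else 0)"

text \<open>\<open>bdf3_kernel t n j\<close> is \<open>b\<^sub>j\<^sup>(\<^sup>n\<^sup>)\<close>.\<close>

definition bdf3_kernel :: "(nat \<Rightarrow> real) \<Rightarrow> nat \<Rightarrow> nat \<Rightarrow> real" where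
  "bdf3_kernel t n j =
    (let r = ratio t n; s = ratio t (n - 1);
         d = tau t n * (1 + r) * (1 + s) * (1 + s + r * s)
     in if n = 0 then 0
        else if n = 1 then (if j = 0 then 1 / tau t 1 else 0)
        else if n = 2 then
          (if j = 0 then (1 + 2 * r) / (tau t 2 * (1 + r))
           else if j = 1 then - (r\<^sup>2 / (tau t 2 * (1 + r)))
           else 0)
        else
          (if j = 0 then (1 + s) * (1 + 2 * r + s * (1 + 4 * r + 3 * r\<^sup>2)) / d
           else if j = 1 then - (r\<^sup>2 * ((1 + 2 * s + r * s)\<^sup>2 - s * (1 + s)) / d)
           else if j = 2 then r\<^sup>2 * s ^ 3 * (1 + r)\<^sup>2 / d
           else 0))"

definition D3 :: "(nat \<Rightarrow> real) \<Rightarrow> (nat \<Rightarrow> 'a \<Rightarrow> real) \<Rightarrow> nat \<Rightarrow> 'a \<Rightarrow> real" where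
  "D3 t u n x = (\<Sum>k = 1..n. bdf3_kernel t n (n - k) * (u k x - u (k - 1) x))"

section \<open>Weak gradients\<close>

primrec C_k :: "nat \<Rightarrow> ('a::euclidean_space \<Rightarrow> real) \<Rightarrow> bool" where
  "C_k 0 f \<longleftrightarrow> continuous_on UNIV f"
| "C_k (Suc k) f \<longleftrightarrow> (\<forall>x. f differentiable (at x)) \<and>
     (\<forall>v. C_k k (\<lambda>x. frechet_derivative f (at x) v))"

definition test_function :: "('a::euclidean_space \<Rightarrow> real) \<Rightarrow> bool" where
  "test_function \<phi> \<longleftrightarrow> (\<forall>k. C_k k \<phi>) \<and> compact (closure {x. \<phi> x \<noteq> 0})"

definition locally_integrable :: "('a::euclidean_space \<Rightarrow> 'b::euclidean_space) \<Rightarrow> bool" where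
  "locally_integrable f \<longleftrightarrow> (\<forall>K. compact K \<longrightarrow> integrable (lebesgue_on K) f)"

text \<open>Weak differentiability is required on the whole space. For a periodic function this is what
  periodic boundary conditions demand: the weak derivative has no singular part on
  the faces of the period cell.\<close>

definition has_weak_gradient :: "('a::euclidean_space \<Rightarrow> real) \<Rightarrow> ('a \<Rightarrow> 'a) \<Rightarrow> bool" where
  "has_weak_gradient u G \<longleftrightarrow> locally_integrable u \<and> locally_integrable G \<and>
    (\<forall>\<phi>. test_function \<phi> \<longrightarrow>
      (\<forall>e\<in>Basis. (\<integral>x. u x * frechet_derivative \<phi> (at x) e \<partial>lebesgue)
                 = - (\<integral>x. (G x \<bullet> e) * \<phi> x \<partial>lebesgue)))"

text \<open>The weak gradient is determined up to a null set, so the choice made here does not affect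
  any integral of it.\<close>

definition weak_gradient :: "('a::euclidean_space \<Rightarrow> real) \<Rightarrow> 'a \<Rightarrow> 'a" where
  "weak_gradient u = (SOME G. has_weak_gradient u G)"

section \<open>Periodic function space\<close>

text \<open>The period vectors \<open>B\<close> are meant to form a basis of the space; the choice
  \<open>B = {L *\<^sub>R e | e. e \<in> Basis}\<close> gives a cube of side \<open>L\<close>.\<close>

definition period_cell :: "'a::euclidean_space \<Rightarrow> 'a set \<Rightarrow> 'a set" where
  "period_cell a B = {a + (\<Sum>b\<in>B. s b *\<^sub>R b) | s. \<forall>b\<in>B. 0 < s b \<and> s b < (1::real)}"

definition periodic :: "'a::euclidean_space set \<Rightarrow> ('a \<Rightarrow> 'b) \<Rightarrow> bool" where
  "periodic B u \<longleftrightarrow> (\<forall>b\<in>B. \<forall>x. u (x + b) = u x)"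

definition Lp_on :: "nat \<Rightarrow> 'a::euclidean_space set \<Rightarrow> ('a \<Rightarrow> 'b::euclidean_space) set" where
  "Lp_on p \<Omega> = {f. f \<in> borel_measurable (lebesgue_on \<Omega>) \<and>
                   integrable (lebesgue_on \<Omega>) (\<lambda>x. norm (f x) ^ p)}"

definition H1_periodic :: "'a::euclidean_space \<Rightarrow> 'a set \<Rightarrow> ('a \<Rightarrow> real) set" where
  "H1_periodic a B = {u. periodic B u \<and> u \<in> Lp_on 2 (period_cell a B) \<and>
     (\<exists>G. has_weak_gradient u G \<and> G \<in> Lp_on 2 (period_cell a B))}"

definition V_space :: "'a::euclidean_space \<Rightarrow> 'a set \<Rightarrow> ('a \<Rightarrow> real) set" where
  "V_space a B = H1_periodic a B \<inter> Lp_on 4 (period_cell a B)"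

section \<open>Scheme and energy\<close>

definition L2_inner ::
    "'a::euclidean_space set \<Rightarrow> ('a \<Rightarrow> 'b::euclidean_space) \<Rightarrow> ('a \<Rightarrow> 'b) \<Rightarrow> real" where
  "L2_inner \<Omega> f g = (\<integral>x. f x \<bullet> g x \<partial>lebesgue_on \<Omega>)"

definition L2_norm :: "'a::euclidean_space set \<Rightarrow> ('a \<Rightarrow> 'b::euclidean_space) \<Rightarrow> real" where
  "L2_norm \<Omega> f = sqrt (L2_inner \<Omega> f f)"

definition f_AC :: "real \<Rightarrow> real" where
  "f_AC z = z ^ 3 - z"

definition bdf3_solution ::
    "real \<Rightarrow> 'a::euclidean_space \<Rightarrow> 'a set \<Rightarrow> (nat \<Rightarrow> real) \<Rightarrow> nat \<Rightarrow> ('a \<Rightarrow> real)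
      \<Rightarrow> (nat \<Rightarrow> 'a \<Rightarrow> real) \<Rightarrow> bool" where
  "bdf3_solution \<epsilon> a B t N u0 u \<longleftrightarrow>
    (let \<Omega> = period_cell a B in
      (\<forall>n\<le>N. u n \<in> V_space a B) \<and> u 0 = u0 \<and>
      (\<forall>n. 1 \<le> n \<and> n \<le> N \<longrightarrow>
        (\<forall>v\<in>V_space a B.
           L2_inner \<Omega> (D3 t u n) v
           + \<epsilon>\<^sup>2 * L2_inner \<Omega> (weak_gradient (u n)) (weak_gradient v)
           + L2_inner \<Omega> (\<lambda>x. f_AC (u n x)) v = 0)))"

definition energy :: "real \<Rightarrow> 'a::euclidean_space set \<Rightarrow> ('a \<Rightarrow> real) \<Rightarrow> real" where
  "energy \<epsilon> \<Omega> v = \<epsilon>\<^sup>2 / 2 * (L2_norm \<Omega> (weak_gradient v))\<^sup>2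
                  + 1 / 4 * (L2_norm \<Omega> (\<lambda>x. (v x)\<^sup>2 - 1))\<^sup>2"

end

theory Submission
  imports Defs "HOL-Computational_Algebra.Polynomial"
begin

text \<open>
Test the scheme at step \<open>n\<close> with the increment \<open>w\<^sub>n = u\<^sup>n - u\<^sup>n\<^sup>-\<^sup>1\<close>. The gradient term is convex and the
double well is convex up to \<open>- u\<^sup>2 / 2\<close>, so
\<open>E(u\<^sup>n) - E(u\<^sup>n\<^sup>-\<^sup>1) \<le> \<parallel>w\<^sub>n\<parallel>\<^sup>2 / 2 - (D\<^sub>3u\<^sup>n, w\<^sub>n)\<close> (\<open>energy_diff_le\<close>). What has to be shown is that the
multistep operator dissipates enough to pay for \<open>\<parallel>w\<^sub>n\<parallel>\<^sup>2 / 2\<close>.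

A single product \<open>D\<^sub>3u\<^sup>n w\<^sub>n\<close> can be negative, because it involves earlier increments. There is however a
nonnegative quadratic form \<open>G\<^sub>n\<close> in \<open>w\<^sub>n, w\<^sub>n\<^sub>-\<^sub>1\<close> (\<open>bdf3_storage\<close>) with \<open>G\<^sub>0 = 0\<close> and
\<open>2 w\<^sub>n D\<^sub>3u\<^sup>n \<ge> G\<^sub>n - G\<^sub>n\<^sub>-\<^sub>1 + (2/5) w\<^sub>n\<^sup>2 / \<tau>\<^sub>n\<close> (\<open>D3_dissipation\<close>), valid pointwise in space as soon as
the step ratios are at most \<open>3/2\<close>. If moreover \<open>\<tau>\<^sub>n \<le> 2/5\<close>, the last term covers \<open>w\<^sub>n\<^sup>2\<close>, and the modified
energy \<open>E(u\<^sup>n) + (1/2) \<integral> G\<^sub>n\<close> does not increase (\<open>bdf3_modified_energy_le\<close>). It equals \<open>E(u\<^sup>0)\<close> at \<open>n = 0\<close>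
and dominates \<open>E(u\<^sup>n)\<close>. The hypotheses give \<open>r\<^sub>n \<le> 1.405\<close> and \<open>\<tau>\<^sub>n \<le> 1/100\<close>.

For fixed ratios \<open>r = r\<^sub>n\<close> and \<open>s = r\<^sub>n\<^sub>-\<^sub>1\<close> the dissipation inequality says that a quadratic form in three
increments is positive semidefinite. Completing squares reduces it to one polynomial inequality in
\<open>(r, s)\<close> on a square (\<open>kernel_polynomial_inequality\<close>), which is read off from Bernstein coefficients.

The analytic point is that \<open>weak_gradient\<close> selects one weak gradient by choice, while the argument
needs the gradient of \<open>w\<^sub>n\<close> to be the difference of the gradients of \<open>u\<^sup>n\<close> and \<open>u\<^sup>n\<^sup>-\<^sup>1\<close>. This is true up to a
null set because weak gradients are unique (\<open>has_weak_gradient_unique\<close>), a consequence of the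
fundamental lemma of the calculus of variations, for which enough test functions are built from
\<open>exp (- 1/x)\<close>.
\<close>

section \<open>Dissipativity of the BDF3 kernels\<close>

text \<open>This is the scalar inequality to which the dissipativity of the kernels reduces. It is certified
in a Bernstein basis of the square \<open>[0, 3/2]\<^sup>2\<close>: written as a combination of the products
\<open>r\<^sup>i (3 - 2 r)\<^sup>6\<^sup>-\<^sup>i s\<^sup>j (3 - 2 s)\<^sup>7\<^sup>-\<^sup>j\<close>, each nonnegative on the square, the difference of the two sides
has only positive coefficients. The factor \<open>531441 = 3\<^sup>1\<^sup>2\<close> makes them integers.\<close>

lemma kernel_polynomial_inequality:
  fixes r s :: real
  assumes "0 \<le> r" "r \<le> 3/2" "0 \<le> s" "s \<le> 3/2"
  shows "r\<^sup>2 * (3 * (5 * (1 + 2 * s + r * s)\<^sup>2 - 5 * s * (1 + s) - 2 * (1 + r) * (1 + s) * (1 + s + r * s))\<^sup>2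
      - 20 * s^4 * (1 + r)\<^sup>2 * (5 * (1 + 2 * s + r * s)\<^sup>2 - 5 * s * (1 + s) - 2 * (1 + r) * (1 + s) * (1 + s + r * s))
      + 125 * s^5 * (1 + r)^4)
    \<le> 10 * (1 + r) * (1 + s)\<^sup>2 * (1 + s + r * s) * (1 + 2 * s + 2 * r * s) * (15 - 4 * s^3)" (is "?L \<le> ?R")
proof -
  define u v where "u = 3 - 2 * r" and "v = 3 - 2 * s"
  have "531441 * (?R - ?L) =
      u^6 * (50 * v^7 + 1450 * s * v^6 + 17250 * s^2 * v^5 + 108590 * s^3 * v^4
          + 385420 * s^4 * v^3 + 742800 * s^5 * v^2 + 629000 * s^6 * v + 40000 * s^7)
      + r * u^5 * (750 * v^7 + 23100 * s * v^6 + 288450 * s^2 * v^5 + 1889400 * s^3 * v^4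
          + 6932580 * s^4 * v^3 + 13751280 * s^5 * v^2 + 11956800 * s^6 * v + 762000 * s^7)
      + r^2 * u^4 * (4419 * v^7 + 145134 * s * v^6 + 1902393 * s^2 * v^5 + 12929562 * s^3 * v^4
          + 48800295 * s^4 * v^3 + 98944065 * s^5 * v^2 + 87538500 * s^6 * v + 4661100 * s^7)
      + r^3 * u^3 * (13676 * v^7 + 475228 * s * v^6 + 6480024 * s^2 * v^5 + 45158432 * s^3 * v^4
          + 172770196 * s^4 * v^3 + 351926940 * s^5 * v^2 + 312881480 * s^6 * v + 11880400 * s^7)
      + r^4 * u^2 * (23676 * v^7 + 870420 * s * v^6 + 12267090 * s^2 * v^5 + 86277930 * s^3 * v^4
          + 325865190 * s^4 * v^3 + 640911402 * s^5 * v^2 + 558802320 * s^6 * v + 17077800 * s^7)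
      + r^5 * u * (21600 * v^7 + 847800 * s * v^6 + 12411900 * s^2 * v^5 + 87178680 * s^3 * v^4
          + 312685920 * s^4 * v^3 + 536291820 * s^5 * v^2 + 419056200 * s^6 * v + 22788000 * s^7)
      + r^6 * (8000 * v^7 + 340000 * s * v^6 + 5257500 * s^2 * v^5 + 37124900 * s^3 * v^4
          + 120751975 * s^4 * v^3 + 124387725 * s^5 * v^2 + 18438500 * s^6 * v + 527500 * s^7)"
    unfolding u_def v_def by algebra
  moreover have "\<dots> \<ge> 0"
    using assms by (intro add_nonneg_nonneg mult_nonneg_nonneg zero_le_power) (auto simp: u_def v_def)
  ultimately show ?thesis by simp
qed

text \<open>One step of the dissipation inequality, multiplied by \<open>\<tau>\<^sub>n\<close> so that only the two ratios \<open>r = r\<^sub>n\<close> and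
\<open>s = r\<^sub>n\<^sub>-\<^sub>1\<close> remain; \<open>X\<close>, \<open>Y\<close>, \<open>Z\<close> are the last three increments. The difference of the two sides is a
quadratic form in \<open>(X, Y, Z)\<close>, and completing squares first in \<open>Z\<close> and then in \<open>Y\<close> leaves a multiple of
\<open>X\<^sup>2\<close> whose coefficient is nonnegative by the polynomial inequality above.\<close>

lemma bdf3_quadratic_form_dissipative:
  fixes r s X Y Z :: real
  assumes r: "0 \<le> r" "r \<le> 3/2" and s: "0 \<le> s" "s \<le> 3/2"
  shows "(8/5 * X\<^sup>2 - 4/5 * r\<^sup>2 * X * Y + 3/5 * r * Y\<^sup>2)
      - r * (8/5 * Y\<^sup>2 - 4/5 * s\<^sup>2 * Y * Z + 3/5 * s * Z\<^sup>2) + 2/5 * X\<^sup>2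
    \<le> 2 * X * ((1 + 2 * r + s * (1 + 4 * r + 3 * r\<^sup>2)) / ((1 + r) * (1 + s + r * s)) * X
        - r\<^sup>2 * ((1 + 2 * s + r * s)\<^sup>2 - s * (1 + s)) / ((1 + r) * (1 + s) * (1 + s + r * s)) * Y
        + r\<^sup>2 * s^3 * (1 + r) / ((1 + s) * (1 + s + r * s)) * Z)"
proof -
  define D where "D = (1 + r) * (1 + s) * (1 + s + r * s)"
  define M where "M = 5 * (1 + 2 * s + r * s)\<^sup>2 - 5 * s * (1 + s) - 2 * (1 + r) * (1 + s) * (1 + s + r * s)"
  \<comment> \<open>With these abbreviations the form is
    \<open>r a X\<^sup>2 + 2 r\<^sup>2 b X Y + 2 r\<^sup>2 s\<^sup>2 c X Z + r (Y\<^sup>2 - 4/5 s\<^sup>2 Y Z + 3/5 s Z\<^sup>2)\<close>. Eliminating \<open>Z\<close> turns the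
    coefficient of \<open>Y\<^sup>2\<close> into \<open>r e\<close> and replaces \<open>b\<close> by \<open>b'\<close>.\<close>
  define a where "a = 2 * (1 + 2 * s + 2 * r * s) / ((1 + r) * (1 + s + r * s))"
  define b where "b = - M / (5 * D)"
  define c where "c = s * (1 + r)\<^sup>2 / D"
  define e where "e = 1 - 4/15 * s^3"
  define b' where "b' = b + 2/3 * s^3 * c"
  have pos: "1 + r > 0" "1 + s > 0" "1 + s + r * s > 0"
    using r s by (auto intro: add_pos_nonneg)
  then have D: "D > 0" by (simp add: D_def)
  \<comment> \<open>At \<open>s = 3/2\<close> the value is \<open>1/10\<close>, so \<open>e\<close> is positive but only just.\<close>
  have "s^3 \<le> (3/2)^3" using s by (intro power_mono) auto
  then have e: "e > 0" by (simp add: e_def power3_eq_cube)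
  have Da: "D\<^sup>2 * a = 2 * (1 + r) * (1 + s)\<^sup>2 * (1 + s + r * s) * (1 + 2 * s + 2 * r * s)"
    using pos unfolding D_def a_def by (simp add: power2_eq_square) (simp add: algebra_simps)
  have Dc: "D * c = s * (1 + r)\<^sup>2" and Db: "5 * (D * b) = - M"
    using D by (simp_all add: b_def c_def)
  have "75 * D\<^sup>2 * (r\<^sup>2 * (5/3 * s^3 * c\<^sup>2 * e + b'\<^sup>2))
      = r\<^sup>2 * (3 * (5 * (D * b))\<^sup>2 + 20 * s^3 * (D * c) * (5 * (D * b)) + 125 * s^3 * (D * c)\<^sup>2)"
    unfolding e_def b'_def by algebra
  also have "\<dots> = r\<^sup>2 * (3 * M\<^sup>2 - 20 * s^4 * (1 + r)\<^sup>2 * M + 125 * s^5 * (1 + r)^4)"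
    unfolding Db Dc by algebra
  also have "\<dots> \<le> 10 * (1 + r) * (1 + s)\<^sup>2 * (1 + s + r * s) * (1 + 2 * s + 2 * r * s) * (15 - 4 * s^3)"
    unfolding M_def by (rule kernel_polynomial_inequality[OF r s])
  also have "\<dots> = 75 * D\<^sup>2 * (a * e)"
    using Da unfolding e_def by algebra
  finally have "r\<^sup>2 * (5/3 * s^3 * c\<^sup>2 * e + b'\<^sup>2) \<le> a * e"
    using D by simp
  then have "(r\<^sup>2 * (5/3 * s^3 * c\<^sup>2 * e + b'\<^sup>2)) / e \<le> a"
    using e by (simp add: pos_divide_le_eq)
  moreover have "(r\<^sup>2 * (5/3 * s^3 * c\<^sup>2 * e + b'\<^sup>2)) / e = r\<^sup>2 * (5/3 * s^3 * c\<^sup>2 + b'\<^sup>2 / e)"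
    using e by (simp add: field_simps)
  ultimately have a_ge: "0 \<le> a - r\<^sup>2 * (5/3 * s^3 * c\<^sup>2 + b'\<^sup>2 / e)" by simp
  define q where "q = b' / e"
  have qe: "q * e = b'" using e by (simp add: q_def)
  have b'e: "b'\<^sup>2 / e = q\<^sup>2 * e" using e by (simp add: q_def power2_eq_square)
  have "0 \<le> r * (a - r\<^sup>2 * (5/3 * s^3 * c\<^sup>2 + b'\<^sup>2 / e)) * X\<^sup>2 + r * e * (Y + r * q * X)\<^sup>2
      + 3/5 * r * s * (Z - 2/3 * s * Y + 5/3 * r * s * c * X)\<^sup>2"
    using a_ge e r s by (intro add_nonneg_nonneg mult_nonneg_nonneg) auto
  also have "\<dots> = r * a * X\<^sup>2 + 2 * r\<^sup>2 * b * X * Y + 2 * r\<^sup>2 * s\<^sup>2 * c * X * Z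
      + r * (Y\<^sup>2 - 4/5 * s\<^sup>2 * Y * Z + 3/5 * s * Z\<^sup>2)"
    using qe unfolding b'e unfolding b'_def e_def by algebra
  finally have Q: "0 \<le> r * a * X\<^sup>2 + 2 * r\<^sup>2 * b * X * Y + 2 * r\<^sup>2 * s\<^sup>2 * c * X * Z
      + r * (Y\<^sup>2 - 4/5 * s\<^sup>2 * Y * Z + 3/5 * s * Z\<^sup>2)" .
  have 0: "(1 + 2 * r + s * (1 + 4 * r + 3 * r\<^sup>2)) / ((1 + r) * (1 + s + r * s)) = 1 + r * a / 2"
    using pos by (simp add: a_def divide_simps) (simp add: algebra_simps power2_eq_square)
  have "((1 + 2 * s + r * s)\<^sup>2 - s * (1 + s)) / D = 2/5 - b"
    using D by (simp add: b_def M_def divide_simps) (simp add: D_def algebra_simps)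
  then have 1: "r\<^sup>2 * ((1 + 2 * s + r * s)\<^sup>2 - s * (1 + s)) / ((1 + r) * (1 + s) * (1 + s + r * s)) = r\<^sup>2 * (2/5 - b)"
    by (simp add: D_def flip: times_divide_eq_right)
  have 2: "r\<^sup>2 * s^3 * (1 + r) / ((1 + s) * (1 + s + r * s)) = r\<^sup>2 * s\<^sup>2 * c"
    using pos by (simp add: c_def D_def divide_simps) (simp add: algebra_simps power2_eq_square power3_eq_cube)
  show ?thesis
    unfolding 0 1 2 using Q by (simp add: algebra_simps power2_eq_square)
qed

text \<open>The storage function of the scheme, a quadratic form in the last two increments. Multiplied by
\<open>\<tau>\<^sub>n\<close> it is \<open>8/5 X\<^sup>2 - 4/5 r\<^sup>2 X Y + 3/5 r Y\<^sup>2\<close> with \<open>r = r\<^sub>n\<close>, which depends on the mesh through one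
ratio only. The three constants are a choice, made so that the resulting linear matrix inequality
holds for all pairs of ratios up to \<open>3/2\<close> with room to spare. Truncated subtraction and division by
zero are used on purpose: the increments of index \<open>\<le> 0\<close> vanish, so the storage is \<open>0\<close> at \<open>n = 0\<close> and the
two start-up steps obey the same formula as all others.\<close>

definition bdf3_storage :: "(nat \<Rightarrow> real) \<Rightarrow> (nat \<Rightarrow> 'a \<Rightarrow> real) \<Rightarrow> nat \<Rightarrow> 'a \<Rightarrow> real" where
  "bdf3_storage t u n x =
    (8/5 * (u n x - u (n - 1) x)\<^sup>2
      - 4/5 * (ratio t n)\<^sup>2 * (u n x - u (n - 1) x) * (u (n - 1) x - u (n - 2) x)) / tau t n
    + 3/5 * (u (n - 1) x - u (n - 2) x)\<^sup>2 / tau t (n - 1)"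

text \<open>The kernels of all three orders in one formula. The convention \<open>r\<^sub>0 = r\<^sub>1 = 0\<close> turns the general
coefficients into those of the first-order and second-order starting steps.\<close>

lemma tau_times_D3:
  assumes "1 \<le> n" "\<And>k. 1 \<le> k \<Longrightarrow> k \<le> n \<Longrightarrow> 0 < tau t k"
  defines "r \<equiv> ratio t n" and "s \<equiv> ratio t (n - 1)"
  shows "tau t n * D3 t u n x =
        (1 + 2 * r + s * (1 + 4 * r + 3 * r\<^sup>2)) / ((1 + r) * (1 + s + r * s)) * (u n x - u (n - 1) x)
        - r\<^sup>2 * ((1 + 2 * s + r * s)\<^sup>2 - s * (1 + s)) / ((1 + r) * (1 + s) * (1 + s + r * s)) * (u (n - 1) x - u (n - 2) x)
        + r\<^sup>2 * s^3 * (1 + r) / ((1 + s) * (1 + s + r * s)) * (u (n - 2) x - u (n - 3) x)"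
proof -
  have tau: "0 < tau t n" using assms by simp
  have ratio_nonneg: "0 \<le> ratio t k" if "k \<le> n" for k
    using that by (auto simp: ratio_def intro!: less_imp_le[OF divide_pos_pos] assms(2))
  have rs: "0 \<le> r" "0 \<le> s" using ratio_nonneg by (auto simp: r_def s_def)
  then have pos: "1 + r > 0" "1 + s > 0" "1 + s + r * s > 0"
    by (auto intro: add_pos_nonneg)
  consider "n = 1" | "n = 2" | m where "n = Suc (Suc (Suc m))"
    using assms(1) by (metis One_nat_def Suc_1 not0_implies_Suc not_one_le_zero)
  then show ?thesis
  proof cases
    case 1
    then show ?thesis
      using tau by (simp add: D3_def bdf3_kernel_def r_def s_def ratio_def)
  next
    case 2
    have s0: "s = 0" by (simp add: s_def 2 ratio_def)
    have D: "D3 t u n x = bdf3_kernel t n 0 * (u n x - u (n - 1) x)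
        + bdf3_kernel t n 1 * (u (n - 1) x - u (n - 2) x)"
      by (simp add: D3_def 2 numeral_2_eq_2)
    have K0: "tau t n * bdf3_kernel t n 0 = (1 + 2 * r) / (1 + r)"
      using 2 tau by (simp add: bdf3_kernel_def Let_def r_def)
    have K1: "tau t n * bdf3_kernel t n 1 = - (r\<^sup>2 / (1 + r))"
      using 2 tau by (simp add: bdf3_kernel_def Let_def r_def)
    show ?thesis
      unfolding D distrib_left mult.assoc[symmetric] K0 K1 s0 by simp
  next
    case 3
    have "{1..n} = insert n (insert (n - 1) (insert (n - 2) {1..m}))"
      using 3 by auto
    moreover have "(\<Sum>k=1..m. bdf3_kernel t n (n - k) * (u k x - u (k - 1) x)) = 0"
      by (rule sum.neutral) (auto simp: 3 bdf3_kernel_def Let_def)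
    ultimately have D: "D3 t u n x = bdf3_kernel t n 0 * (u n x - u (n - 1) x)
        + bdf3_kernel t n 1 * (u (n - 1) x - u (n - 2) x)
        + bdf3_kernel t n 2 * (u (n - 2) x - u (n - 3) x)"
      using 3 by (simp add: D3_def numeral_2_eq_2 numeral_3_eq_3)
    have n: "n \<noteq> 0" "n \<noteq> 1" "n \<noteq> 2" using 3 by auto
    have K0: "tau t n * bdf3_kernel t n 0 = (1 + 2 * r + s * (1 + 4 * r + 3 * r\<^sup>2)) / ((1 + r) * (1 + s + r * s))"
      and K1: "tau t n * bdf3_kernel t n 1 = - (r\<^sup>2 * ((1 + 2 * s + r * s)\<^sup>2 - s * (1 + s)) / ((1 + r) * (1 + s) * (1 + s + r * s)))"
      and K2: "tau t n * bdf3_kernel t n 2 = r\<^sup>2 * s^3 * (1 + r) / ((1 + s) * (1 + s + r * s))"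
      unfolding bdf3_kernel_def Let_def r_def[symmetric] s_def[symmetric]
      using n tau pos by (simp_all add: power2_eq_square)
    show ?thesis
      unfolding D distrib_left mult.assoc[symmetric] K0 K1 K2 by simp
  qed
qed

text \<open>The kernels are dissipative: in a sum over the steps the storage terms telescope, which bounds the
sum of \<open>D\<^sub>3u\<^sup>n \<nabla>\<^sub>\<tau>u\<^sup>n\<close> from below by a positive multiple of the sum of \<open>(\<nabla>\<^sub>\<tau>u\<^sup>n)\<^sup>2 / \<tau>\<^sub>n\<close>.\<close>

lemma D3_dissipation:
  assumes n: "1 \<le> n" and tau: "\<And>k. 1 \<le> k \<Longrightarrow> k \<le> n \<Longrightarrow> 0 < tau t k"
    and ratio: "\<And>k. 2 \<le> k \<Longrightarrow> k \<le> n \<Longrightarrow> ratio t k \<le> 3/2"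
  shows "bdf3_storage t u n x - bdf3_storage t u (n - 1) x + 2/5 * (u n x - u (n - 1) x)\<^sup>2 / tau t n
    \<le> 2 * (u n x - u (n - 1) x) * D3 t u n x"
proof -
  define r s where "r = ratio t n" and "s = ratio t (n - 1)"
  define X Y Z where "X = u n x - u (n - 1) x" and "Y = u (n - 1) x - u (n - 2) x"
    and "Z = u (n - 2) x - u (n - 3) x"
  have ratio_bounds: "0 \<le> ratio t k \<and> ratio t k \<le> 3/2" if "k \<le> n" for k
    using that ratio[of k] by (auto simp: ratio_def intro!: less_imp_le[OF divide_pos_pos] tau)
  have taun: "0 < tau t n" using n tau by simp
  have G: "tau t n * bdf3_storage t u n x = 8/5 * X\<^sup>2 - 4/5 * r\<^sup>2 * X * Y + 3/5 * r * Y\<^sup>2"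
  proof (cases "n = 1")
    case True
    then show ?thesis using taun by (simp add: bdf3_storage_def X_def Y_def)
  next
    case False
    then have "r = tau t n / tau t (n - 1)" "0 < tau t (n - 1)" using n tau[of "n - 1"] by (auto simp: r_def ratio_def)
    then show ?thesis
      using taun unfolding bdf3_storage_def X_def[symmetric] Y_def[symmetric] r_def[symmetric]
      by (simp add: field_simps)
  qed
  have G': "tau t n * bdf3_storage t u (n - 1) x = r * (8/5 * Y\<^sup>2 - 4/5 * s\<^sup>2 * Y * Z + 3/5 * s * Z\<^sup>2)"
  proof -
    consider "n = 1" | "n = 2" | "3 \<le> n" using n by linarith
    then show ?thesis
    proof cases
      case 1
      then show ?thesis by (simp add: bdf3_storage_def r_def ratio_def tau_def)
    next
      case 2
      then show ?thesis by (simp add: bdf3_storage_def r_def s_def Y_def ratio_def)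
    next
      case 3
      then have p: "0 < tau t (n - 1)" "0 < tau t (n - 2)" by (simp_all add: tau)
      then have r: "tau t n = r * tau t (n - 1)" and s: "tau t (n - 1) = s * tau t (n - 2)"
        using 3 by (simp_all add: r_def s_def ratio_def numeral_2_eq_2)
      have idx: "n - 1 - 1 = n - 2" "n - 1 - 2 = n - 3" by auto
      have "tau t (n - 1) * bdf3_storage t u (n - 1) x = 8/5 * Y\<^sup>2 - 4/5 * s\<^sup>2 * Y * Z + 3/5 * s * Z\<^sup>2"
        using p unfolding bdf3_storage_def idx Y_def[symmetric] Z_def[symmetric] s_def[symmetric]
        by (simp add: distrib_left) (use s in simp)
      then show ?thesis unfolding r by (simp add: mult.assoc)
    qed
  qed
  have tau_D3: "tau t n * D3 t u n x =
        (1 + 2 * r + s * (1 + 4 * r + 3 * r\<^sup>2)) / ((1 + r) * (1 + s + r * s)) * X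
        - r\<^sup>2 * ((1 + 2 * s + r * s)\<^sup>2 - s * (1 + s)) / ((1 + r) * (1 + s) * (1 + s + r * s)) * Y
        + r\<^sup>2 * s^3 * (1 + r) / ((1 + s) * (1 + s + r * s)) * Z"
    unfolding r_def s_def X_def Y_def Z_def by (rule tau_times_D3) (use n tau in auto)
  have "tau t n * (bdf3_storage t u n x - bdf3_storage t u (n - 1) x + 2/5 * X\<^sup>2 / tau t n)
     = (8/5 * X\<^sup>2 - 4/5 * r\<^sup>2 * X * Y + 3/5 * r * Y\<^sup>2)
      - r * (8/5 * Y\<^sup>2 - 4/5 * s\<^sup>2 * Y * Z + 3/5 * s * Z\<^sup>2) + 2/5 * X\<^sup>2"
    using G G' taun by (simp add: algebra_simps)
  also have "\<dots> \<le> 2 * X * (tau t n * D3 t u n x)"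
    unfolding tau_D3
    using ratio_bounds by (intro bdf3_quadratic_form_dissipative) (auto simp: r_def s_def)
  finally show ?thesis
    using taun unfolding X_def by (simp add: mult.left_commute)
qed

lemma bdf3_storage_nonneg:
  assumes n: "1 \<le> n" and tau: "\<And>k. 1 \<le> k \<Longrightarrow> k \<le> n \<Longrightarrow> 0 < tau t k"
    and ratio: "2 \<le> n \<Longrightarrow> ratio t n \<le> 3/2"
  shows "0 \<le> bdf3_storage t u n x"
proof (cases "n = 1")
  case True
  then show ?thesis using tau[of 1] by (simp add: bdf3_storage_def)
next
  case False
  define r X Y where "r = ratio t n" and "X = u n x - u (n - 1) x" and "Y = u (n - 1) x - u (n - 2) x"
  have p: "0 < tau t n" "0 < tau t (n - 1)" and r: "r = tau t n / tau t (n - 1)"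
    using n False tau[of n] tau[of "n - 1"] by (auto simp: r_def ratio_def)
  then have r0: "0 < r" "r \<le> 3/2" using n False ratio by (auto simp: r_def)
  have "tau t n * bdf3_storage t u n x = 8/5 * (X - 1/4 * r\<^sup>2 * Y)\<^sup>2 + r * (3/5 - 1/10 * r^3) * Y\<^sup>2"
    using p r unfolding bdf3_storage_def X_def[symmetric] Y_def[symmetric] r_def[symmetric]
    by (simp add: field_simps power2_eq_square power3_eq_cube)
  moreover have "r^3 \<le> (3/2)^3" using r0 by (intro power_mono) auto
  then have "0 \<le> 3/5 - 1/10 * r^3" by (simp add: power3_eq_cube)
  ultimately have "0 \<le> tau t n * bdf3_storage t u n x"
    using r0 by simp
  then show ?thesis using p by (simp add: zero_le_mult_iff)
qed

section \<open>Calculus of smooth functions\<close>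

lemma C_k_SucD: "C_k (Suc k) f \<Longrightarrow> C_k k f"
proof (induction k arbitrary: f)
  case 0
  then show ?case
    by (auto intro!: continuous_at_imp_continuous_on differentiable_imp_continuous_within)
next
  case (Suc k)
  have "C_k k (\<lambda>x. frechet_derivative f (at x) v)" for v
    using Suc.prems by (intro Suc.IH) simp
  with Suc.prems show ?case by simp
qed

lemma C_k_SucI:
  assumes "\<And>x. (f has_derivative f' x) (at x)" and "\<And>v. C_k k (\<lambda>x. f' x v)"
  shows "C_k (Suc k) f"
proof -
  have "frechet_derivative f (at x) = f' x" for x
    using frechet_derivative_at[OF assms(1)] by simp
  then show ?thesis using assms by (auto simp: differentiable_def)
qed

lemma C_k_imp_has_derivative:
  "C_k (Suc k) f \<Longrightarrow> (f has_derivative frechet_derivative f (at x)) (at x)"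
  by (simp flip: frechet_derivative_works)

lemma C_k_const: "C_k k (\<lambda>x. c)"
proof (induction k arbitrary: c)
  case (Suc k)
  show ?case by (rule C_k_SucI[where f' = "\<lambda>_ _. 0"]) (auto intro: Suc)
qed simp

lemma C_k_inner_right: "C_k k (\<lambda>x. x \<bullet> e)"
proof (cases k)
  case (Suc k)
  show ?thesis unfolding Suc
    by (rule C_k_SucI[where f' = "\<lambda>_ v. v \<bullet> e"]) (auto intro!: derivative_eq_intros C_k_const)
qed (auto intro!: continuous_intros)

lemma C_k_add: "C_k k f \<Longrightarrow> C_k k g \<Longrightarrow> C_k k (\<lambda>x. f x + g x)"
proof (induction k arbitrary: f g)
  case (Suc k)
  show ?case
  proof (rule C_k_SucI)
    show "((\<lambda>x. f x + g x) has_derivative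
        (\<lambda>v. frechet_derivative f (at x) v + frechet_derivative g (at x) v)) (at x)" for x
      using Suc.prems by (intro has_derivative_add C_k_imp_has_derivative)
  qed (use Suc in auto)
qed (auto intro: continuous_on_add)

lemma C_k_mult: "C_k k f \<Longrightarrow> C_k k g \<Longrightarrow> C_k k (\<lambda>x. f x * g x)"
proof (induction k arbitrary: f g)
  case (Suc k)
  show ?case
  proof (rule C_k_SucI)
    show "((\<lambda>x. f x * g x) has_derivative
        (\<lambda>v. f x * frechet_derivative g (at x) v + frechet_derivative f (at x) v * g x)) (at x)" for x
      using Suc.prems by (intro has_derivative_mult C_k_imp_has_derivative)
    show "C_k k (\<lambda>x. f x * frechet_derivative g (at x) v + frechet_derivative f (at x) v * g x)" for v
      using Suc.prems C_k_SucD[OF Suc.prems(1)] C_k_SucD[OF Suc.prems(2)]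
      by (intro C_k_add Suc.IH) auto
  qed
qed (auto intro: continuous_on_mult)

lemma C_k_prod: "(\<And>i. i \<in> I \<Longrightarrow> C_k k (f i)) \<Longrightarrow> C_k k (\<lambda>x. \<Prod>i\<in>I. f i x)"
  by (induction I rule: infinite_finite_induct) (auto intro: C_k_const C_k_mult)

text \<open>The derivative of \<open>h \<circ> f\<close> in direction \<open>v\<close> is \<open>h'(f x)\<close> times the derivative of \<open>f\<close>, where \<open>h'(y)\<close> is the
derivative of \<open>h\<close> at \<open>y\<close> in direction \<open>1\<close>. The induction applies to \<open>h'\<close>, which is why it runs over all \<open>h\<close>.\<close>

lemma C_k_compose:
  fixes h :: "real \<Rightarrow> real" and f :: "'a::euclidean_space \<Rightarrow> real"
  shows "C_k k h \<Longrightarrow> C_k k f \<Longrightarrow> C_k k (\<lambda>x. h (f x))"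
proof (induction k arbitrary: h)
  case 0
  then show ?case
    using continuous_on_compose2[of UNIV h UNIV f] by simp
next
  case (Suc k)
  show ?case
  proof (rule C_k_SucI)
    fix x
    have h: "(h has_derivative frechet_derivative h (at y)) (at y)" for y
      using Suc.prems(1) by (rule C_k_imp_has_derivative)
    have D: "frechet_derivative h (at (f x)) v = frechet_derivative h (at (f x)) 1 * v" for v
      using linear_cmul[OF has_derivative_linear[OF h], of "f x" v 1] by simp
    have "((\<lambda>x. h (f x)) has_derivative
        (\<lambda>v. frechet_derivative h (at (f x)) (frechet_derivative f (at x) v))) (at x)"
      using h Suc.prems(2) by (intro has_derivative_compose[OF _ h] C_k_imp_has_derivative)
    then show "((\<lambda>x. h (f x)) has_derivative
        (\<lambda>v. frechet_derivative h (at (f x)) 1 * frechet_derivative f (at x) v)) (at x)"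
      by (subst (asm) D)
  next
    show "C_k k (\<lambda>x. frechet_derivative h (at (f x)) 1 * frechet_derivative f (at x) v)" for v
      using Suc.prems C_k_SucD[OF Suc.prems(2)]
      by (intro C_k_mult Suc.IH[of "\<lambda>y. frechet_derivative h (at y) 1"]) auto
  qed
qed

text \<open>The polynomial factor makes this family closed under differentiation, so that smoothness of
\<open>x \<mapsto> exp (- 1/x)\<close>, extended by \<open>0\<close>, follows by induction for all members at once.\<close>

definition flat_exp :: "real poly \<Rightarrow> real \<Rightarrow> real" where
  "flat_exp p x = (if 0 < x then poly p (1 / x) * exp (- (1 / x)) else 0)"

lemma poly_exp_neg_tendsto_0: "((\<lambda>y. poly p y * exp (- y)) \<longlongrightarrow> (0::real)) at_top"
proof -
  have "((\<lambda>y. \<Sum>i\<le>degree p. coeff p i * (y ^ i / exp y)) \<longlongrightarrow> (\<Sum>i\<le>degree p. coeff p i * 0)) at_top"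
    by (intro tendsto_intros tendsto_power_div_exp_0)
  moreover have "(\<Sum>i\<le>degree p. coeff p i * (y ^ i / exp y)) = poly p y * exp (- y)" for y :: real
    by (simp add: poly_altdef exp_minus sum_distrib_right divide_inverse mult.assoc)
  ultimately show ?thesis by simp
qed

lemma flat_exp_has_derivative:
  "(flat_exp p has_real_derivative flat_exp (monom 1 2 * (p - pderiv p)) x) (at x)"
proof (cases "x = 0")
  case False
  show ?thesis
  proof (cases "0 < x")
    case True
    have "((\<lambda>x. poly p (1 / x) * exp (- (1 / x))) has_real_derivative
        flat_exp (monom 1 2 * (p - pderiv p)) x) (at x)"
      using True
      by (auto intro!: derivative_eq_intros simp: flat_exp_def poly_monom field_simps power2_eq_square)
    moreover have "\<forall>\<^sub>F y in nhds x. flat_exp p y = poly p (1 / y) * exp (- (1 / y))"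
      using eventually_nhds_in_open[of "{0<..}" x] True
      by (auto elim!: eventually_mono simp: flat_exp_def)
    ultimately show ?thesis
      by (subst DERIV_cong_ev[OF refl _ refl]) auto
  next
    case neg: False
    have "((\<lambda>_. 0) has_real_derivative flat_exp (monom 1 2 * (p - pderiv p)) x) (at x)"
      using neg by (auto simp: flat_exp_def)
    moreover have "\<forall>\<^sub>F y in nhds x. flat_exp p y = 0"
      using eventually_nhds_in_open[of "{..<0}" x] neg False
      by (auto elim!: eventually_mono simp: flat_exp_def)
    ultimately show ?thesis
      by (subst DERIV_cong_ev[OF refl _ refl]) auto
  qed
next
  case True
  have "((\<lambda>h. flat_exp p h / h) \<longlongrightarrow> 0) (at 0)"
  proof (rule filterlim_split_at)
    show "((\<lambda>h. flat_exp p h / h) \<longlongrightarrow> 0) (at_left 0)"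
      by (rule tendsto_eventually) (auto simp: eventually_at_filter flat_exp_def)
    have "((\<lambda>h. poly (pCons 0 p) (inverse h) * exp (- inverse h)) \<longlongrightarrow> 0) (at_right 0)"
      by (rule filterlim_compose[OF poly_exp_neg_tendsto_0 filterlim_inverse_at_top_right])
    moreover have "\<forall>\<^sub>F h in at_right 0. poly (pCons 0 p) (inverse h) * exp (- inverse h) = flat_exp p h / h"
      by (auto simp: eventually_at_filter flat_exp_def field_simps)
    ultimately show "((\<lambda>h. flat_exp p h / h) \<longlongrightarrow> 0) (at_right 0)"
      by (rule Lim_transform_eventually)
  qed
  then show ?thesis
    unfolding True by (simp add: has_field_derivative_iff flat_exp_def)
qed

lemma C_k_flat_exp: "C_k k (flat_exp p)"
proof (induction k arbitrary: p)
  case 0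
  then show ?case
    by (simp add: continuous_at_imp_continuous_on DERIV_isCont[OF flat_exp_has_derivative])
next
  case (Suc k)
  let ?q = "monom 1 2 * (p - pderiv p)"
  have "(\<lambda>v. flat_exp (smult v ?q) x) = (*) (flat_exp ?q x)" for x
    by (rule ext) (simp add: flat_exp_def)
  then have "(flat_exp p has_derivative (\<lambda>v. flat_exp (smult v ?q) x)) (at x)" for x
    using flat_exp_has_derivative[of p x] by (simp only: has_field_derivative_def)
  then show ?case by (rule C_k_SucI) (rule Suc)
qed

section \<open>Test functions and the fundamental lemma of the calculus of variations\<close>

lemma flat_exp_1_range: "0 \<le> flat_exp 1 x" "flat_exp 1 x \<le> 1"
  by (auto simp: flat_exp_def)

text \<open>A smooth function that is positive exactly on the open box. The differences are written as sums so
that the closure properties of \<open>C_k\<close> apply as they stand.\<close>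

definition box_bump :: "'a::euclidean_space \<Rightarrow> 'a \<Rightarrow> 'a \<Rightarrow> real" where
  "box_bump l u x = (\<Prod>e\<in>Basis. flat_exp 1 (x \<bullet> e + - (l \<bullet> e)) * flat_exp 1 (u \<bullet> e + (- 1) * (x \<bullet> e)))"

lemma C_k_box_bump: "C_k k (box_bump l u)"
  unfolding box_bump_def
  by (intro C_k_prod C_k_mult C_k_compose[OF C_k_flat_exp] C_k_add C_k_const C_k_inner_right)

lemma box_bump_nonneg: "0 \<le> box_bump l u x"
  by (auto simp: box_bump_def intro!: prod_nonneg mult_nonneg_nonneg flat_exp_1_range)

lemma box_bump_pos_iff: "0 < box_bump l u x \<longleftrightarrow> x \<in> box l u"
proof -
  have "0 < box_bump l u x \<longleftrightarrow> box_bump l u x \<noteq> 0"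
    using box_bump_nonneg[of l u x] by auto
  also have "\<dots> \<longleftrightarrow> (\<forall>e\<in>Basis. flat_exp 1 (x \<bullet> e + - (l \<bullet> e)) \<noteq> 0 \<and> flat_exp 1 (u \<bullet> e + (- 1) * (x \<bullet> e)) \<noteq> 0)"
    by (simp add: box_bump_def)
  also have "\<dots> \<longleftrightarrow> x \<in> box l u"
    by (auto simp: mem_box flat_exp_def)
  finally show ?thesis .
qed

lemma test_function_box:
  "test_function (\<lambda>x. flat_exp 1 (c * box_bump l u x))" if "0 \<le> c"
proof -
  have "{x. flat_exp 1 (c * box_bump l u x) \<noteq> 0} \<subseteq> cbox l u"
    using box_bump_pos_iff[of l u] box_subset_cbox[of l u] that
    by (auto simp: flat_exp_def zero_less_mult_iff split: if_splits)
  then have "closure {x. flat_exp 1 (c * box_bump l u x) \<noteq> 0} \<subseteq> cbox l u"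
    by (rule closure_minimal[OF _ closed_cbox])
  then have "compact (closure {x. flat_exp 1 (c * box_bump l u x) \<noteq> 0})"
    by (rule bounded_subset[OF bounded_cbox, THEN compact_eq_bounded_closed[THEN iffD2, OF conjI]]) simp
  then show ?thesis
    unfolding test_function_def
    by (auto intro!: C_k_compose[OF C_k_flat_exp] C_k_mult C_k_const C_k_box_bump)
qed

text \<open>Composing the bump with \<open>exp (- 1/(k y))\<close> for growing \<open>k\<close> pushes its positive values to \<open>1\<close> and
keeps its zeros, without leaving the class of smooth functions supported in the box.\<close>

lemma test_functions_tendsto_indicator_box:
  "(\<lambda>k. flat_exp 1 (real (Suc k) * box_bump l u x)) \<longlonglongrightarrow> indicator (box l u) x"
proof (cases "x \<in> box l u")
  case True
  then have p: "0 < box_bump l u x" by (simp add: box_bump_pos_iff)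
  have "(\<lambda>k. exp (- (inverse (box_bump l u x) * inverse (real (Suc k))))) \<longlonglongrightarrow> exp (- (inverse (box_bump l u x) * 0))"
    by (intro tendsto_intros LIMSEQ_inverse_real_of_nat)
  moreover have "flat_exp 1 (real (Suc k) * box_bump l u x) = exp (- (inverse (box_bump l u x) * inverse (real (Suc k))))" for k
    using mult_pos_pos[OF _ p, of "real (Suc k)"] by (simp add: flat_exp_def field_simps del: of_nat_Suc)
  ultimately show ?thesis using True by simp
next
  case False
  then have "box_bump l u x = 0"
    using box_bump_pos_iff[of l u x] box_bump_nonneg[of l u x] by auto
  with False show ?thesis by (simp add: flat_exp_def)
qed

lemma integrable_lebesgue_on_subset:
  fixes f :: "'a::euclidean_space \<Rightarrow> 'b::euclidean_space"
  assumes "integrable (lebesgue_on S) f" "S \<in> sets lebesgue" "T \<in> sets lebesgue" "T \<subseteq> S"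
  shows "integrable (lebesgue_on T) f"
  using set_integrable_subset[of lebesgue S f T] assms
  by (simp add: set_integrable_def integrable_restrict_space)

lemma integrable_mult_compact_support:
  fixes u \<phi> :: "'a::euclidean_space \<Rightarrow> real"
  assumes u: "locally_integrable u" and cont: "continuous_on UNIV \<phi>"
    and K: "compact K" "\<And>x. x \<notin> K \<Longrightarrow> \<phi> x = 0"
  shows "integrable lebesgue (\<lambda>x. u x * \<phi> x)"
proof -
  have Ks: "K \<in> sets lebesgue" using K(1) by (simp add: lmeasurable_compact fmeasurableD)
  have int: "integrable lebesgue (\<lambda>x. if x \<in> K then u x else 0)"
    using u K(1) by (auto simp: locally_integrable_def Lebesgue_Measure.integrable_restrict_UNIV[OF Ks])
  have "compact (\<phi> ` K)"
    using cont K(1) by (meson compact_continuous_image continuous_on_subset subset_UNIV)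
  then have "\<exists>C. \<forall>x\<in>K. \<bar>\<phi> x\<bar> \<le> C"
    by (auto dest!: compact_imp_bounded simp: bounded_iff)
  then obtain C where C: "\<And>x. x \<in> K \<Longrightarrow> \<bar>\<phi> x\<bar> \<le> C" by blast
  have meas: "\<phi> \<in> borel_measurable lebesgue"
    using cont by (intro measurable_completion) (simp add: borel_measurable_continuous_onI)
  have eq: "(\<lambda>x. u x * \<phi> x) = (\<lambda>x. (if x \<in> K then u x else 0) * \<phi> x)"
    using K(2) by (auto simp: fun_eq_iff)
  show ?thesis unfolding eq
  proof (rule Bochner_Integration.integrable_bound)
    show "integrable lebesgue (\<lambda>x. C * (if x \<in> K then u x else 0))"
      using int by (rule integrable_mult_right)
    show "(\<lambda>x. (if x \<in> K then u x else 0) * \<phi> x) \<in> borel_measurable lebesgue"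
      by (rule borel_measurable_times[OF borel_measurable_integrable[OF int] meas])
    show "AE x in lebesgue. norm ((if x \<in> K then u x else 0) * \<phi> x) \<le> norm (C * (if x \<in> K then u x else 0))"
    proof (rule AE_I2)
      fix x
      have "\<bar>u x\<bar> * \<bar>\<phi> x\<bar> \<le> \<bar>u x\<bar> * \<bar>C\<bar>" if "x \<in> K"
        using C[OF that] by (intro mult_left_mono) auto
      then show "norm ((if x \<in> K then u x else 0) * \<phi> x) \<le> norm (C * (if x \<in> K then u x else 0))"
        by (auto simp: abs_mult mult.commute)
    qed
  qed
qed

lemma integrable_mult_test_function:
  fixes u :: "'a::euclidean_space \<Rightarrow> real"
  assumes "locally_integrable u" "test_function \<phi>"
  shows "integrable lebesgue (\<lambda>x. u x * \<phi> x)"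
    and "integrable lebesgue (\<lambda>x. u x * frechet_derivative \<phi> (at x) e)"
proof -
  let ?K = "closure {x. \<phi> x \<noteq> 0}"
  have C: "C_k k \<phi>" for k using assms(2) by (auto simp: test_function_def)
  have K: "compact ?K" using assms(2) by (auto simp: test_function_def)
  have 0: "\<phi> x = 0" if "x \<notin> ?K" for x using that closure_subset[of "{x. \<phi> x \<noteq> 0}"] by auto
  show "integrable lebesgue (\<lambda>x. u x * \<phi> x)"
    using C[of 0] by (intro integrable_mult_compact_support[OF assms(1) _ K 0]) simp_all
  have D0: "frechet_derivative \<phi> (at x) e = 0" if "x \<notin> ?K" for x
  proof -
    have "(\<phi> has_derivative (\<lambda>_. 0)) (at x)"
    proof (rule has_derivative_transform_within_open[OF has_derivative_const])
      show "open (- ?K)" "x \<in> - ?K" using that by auto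
      show "0 = \<phi> y" if "y \<in> - ?K" for y using 0[of y] that by auto
    qed
    from fun_cong[OF frechet_derivative_at[OF this], of e] show ?thesis by simp
  qed
  show "integrable lebesgue (\<lambda>x. u x * frechet_derivative \<phi> (at x) e)"
    using C[of "Suc 0"] by (intro integrable_mult_compact_support[OF assms(1) _ K D0]) simp_all
qed

text \<open>By Henstock's lemma the sum of \<open>\<parallel>|k| f(x) - \<integral>\<^sub>k f\<parallel>\<close> over a fine tagged division is small. When the
integrals over the boxes \<open>k\<close> vanish, this sum is a Riemann sum of \<open>\<parallel>f\<parallel>\<close>.\<close>

lemma norm_has_integral_0_if_box_integrals_0:
  fixes f :: "'a::euclidean_space \<Rightarrow> 'b::euclidean_space"
  assumes f: "f integrable_on cbox a b"
    and 0: "\<And>c d. cbox c d \<subseteq> cbox a b \<Longrightarrow> integral (cbox c d) f = 0"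
  shows "((\<lambda>x. norm (f x)) has_integral 0) (cbox a b)"
  unfolding has_integral
proof (intro allI impI)
  fix e :: real assume "e > 0"
  obtain \<gamma> where \<gamma>: "gauge \<gamma>"
    "\<And>p. \<lbrakk>p tagged_partial_division_of (cbox a b); \<gamma> fine p\<rbrakk> \<Longrightarrow>
             sum (\<lambda>(x,k). norm (measure lborel k *\<^sub>R f x - integral k f)) p < e"
    using Henstock_lemma[OF f \<open>e > 0\<close>] by blast
  show "\<exists>\<gamma>. gauge \<gamma> \<and> (\<forall>\<D>. \<D> tagged_division_of (cbox a b) \<and> \<gamma> fine \<D> \<longrightarrow>
      norm ((\<Sum>(x,k)\<in>\<D>. measure lborel k *\<^sub>R norm (f x)) - 0) < e)"
  proof (intro exI conjI allI impI)
    show "gauge \<gamma>" by fact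
    fix p assume p: "p tagged_division_of (cbox a b) \<and> \<gamma> fine p"
    have "(\<Sum>(x,k)\<in>p. measure lborel k *\<^sub>R norm (f x)) = (\<Sum>(x,k)\<in>p. norm (measure lborel k *\<^sub>R f x - integral k f))"
    proof (rule sum.cong, simp, clarify)
      fix x k assume xk: "(x, k) \<in> p"
      obtain c d where "k = cbox c d" "k \<subseteq> cbox a b"
        using tagged_division_ofD(3,4)[of p "cbox a b" x k] p xk by auto
      then have "integral k f = 0" using 0 by auto
      then show "measure lborel k *\<^sub>R norm (f x) = norm (measure lborel k *\<^sub>R f x - integral k f)" by simp
    qed
    also have "\<dots> < e" using p \<gamma>(2)[of p] by (auto simp: tagged_division_of_def)
    finally have "(\<Sum>(x,k)\<in>p. measure lborel k *\<^sub>R norm (f x)) < e" .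
    moreover have "0 \<le> (\<Sum>(x,k)\<in>p. measure lborel k *\<^sub>R norm (f x))" by (rule sum_nonneg) auto
    ultimately show "norm ((\<Sum>(x,k)\<in>p. measure lborel k *\<^sub>R norm (f x)) - 0) < e" by simp
  qed
qed

text \<open>Testing with the approximations of the indicator of a box shows that \<open>g\<close> has integral \<open>0\<close> over every
box, hence \<open>|g|\<close> does too, and \<open>g\<close> vanishes almost everywhere on each cube of an exhausting sequence.\<close>

lemma fundamental_lemma_calculus_of_variations:
  fixes g :: "'a::euclidean_space \<Rightarrow> real"
  assumes g: "locally_integrable g"
    and 0: "\<And>\<phi>. test_function \<phi> \<Longrightarrow> (\<integral>x. g x * \<phi> x \<partial>lebesgue) = 0"
  shows "AE x in lebesgue. g x = 0"
proof -
  have int: "integrable (lebesgue_on (cbox l u)) g" for l u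
    using g by (simp add: locally_integrable_def)
  have int': "integrable lebesgue (\<lambda>x. if x \<in> cbox l u then g x else 0)" for l u
    using int by (simp add: Lebesgue_Measure.integrable_restrict_UNIV)
  have box0: "integral (cbox l u) g = 0" for l u
  proof -
    define \<phi> where "\<phi> k x = flat_exp 1 (real (Suc k) * box_bump l u x)" for k x
    have \<phi>: "test_function (\<phi> k)" for k unfolding \<phi>_def by (rule test_function_box) simp
    have out: "\<phi> k x = 0" if "x \<notin> cbox l u" for k x
      using that box_bump_pos_iff[of l u x] box_bump_nonneg[of l u x] box_subset_cbox[of l u]
      by (auto simp: \<phi>_def flat_exp_def zero_less_mult_iff)
    have "(\<lambda>k. \<integral>x. g x * \<phi> k x \<partial>lebesgue) \<longlonglongrightarrow> (\<integral>x. (if x \<in> cbox l u then g x else 0) * indicator (box l u) x \<partial>lebesgue)"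
    proof (rule integral_dominated_convergence)
      show "(\<lambda>x. g x * \<phi> k x) \<in> borel_measurable lebesgue" for k
        using integrable_mult_test_function(1)[OF g \<phi>] by (rule borel_measurable_integrable)
      show "(\<lambda>x. (if x \<in> cbox l u then g x else 0) * indicator (box l u) x) \<in> borel_measurable lebesgue"
        by (rule borel_measurable_times[OF borel_measurable_integrable[OF int'] borel_measurable_indicator]) simp
      show "integrable lebesgue (\<lambda>x. norm (if x \<in> cbox l u then g x else 0))"
        using int' by (rule integrable_norm)
      have restrict: "g x * \<phi> k x = (if x \<in> cbox l u then g x else 0) * \<phi> k x" for x k
        using out by auto
      have "(\<lambda>k. (if x \<in> cbox l u then g x else 0) * \<phi> k x) \<longlonglongrightarrow> (if x \<in> cbox l u then g x else 0) * indicator (box l u) x" for x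
        unfolding \<phi>_def by (intro tendsto_intros test_functions_tendsto_indicator_box)
      then show "AE x in lebesgue. (\<lambda>k. g x * \<phi> k x) \<longlonglongrightarrow> (if x \<in> cbox l u then g x else 0) * indicator (box l u) x"
        unfolding restrict by (rule AE_I2)
      show "AE x in lebesgue. norm (g x * \<phi> k x) \<le> norm (if x \<in> cbox l u then g x else 0)" for k
        using out[of _ k] flat_exp_1_range by (auto simp: abs_mult \<phi>_def intro!: mult_left_le)
    qed
    then have "(\<integral>x. (if x \<in> cbox l u then g x else 0) * indicator (box l u) x \<partial>lebesgue) = 0"
      using 0[OF \<phi>] by (simp add: LIMSEQ_const_iff)
    moreover have "(\<lambda>x. (if x \<in> cbox l u then g x else 0) * indicator (box l u) x) = (\<lambda>x. if x \<in> box l u then g x else 0)"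
      using box_subset_cbox[of l u] by (auto simp: fun_eq_iff indicator_def)
    ultimately have L0: "integral\<^sup>L (lebesgue_on (box l u)) g = 0"
      by (simp add: Lebesgue_Measure.integral_restrict_UNIV)
    have "integrable (lebesgue_on (box l u)) g"
      using int[of l u] by (rule integrable_lebesgue_on_subset) (auto simp: box_subset_cbox)
    then show ?thesis
      using L0 lebesgue_integral_eq_integral[of "box l u" g] by (simp add: integral_open_interval)
  qed
  have hk: "g integrable_on cbox l u" for l u
    by (rule has_integral_integrable[OF has_integral_integral_lebesgue_on[OF int]]) simp
  define Q where "Q n = cbox (- (real n *\<^sub>R One)) (real n *\<^sub>R (One :: 'a))" for n :: nat
  have "AE x in lebesgue. x \<in> Q n \<longrightarrow> g x = 0" for n
  proof -
    have "((\<lambda>x. norm (g x)) has_integral 0) (Q n)"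
      unfolding Q_def by (rule norm_has_integral_0_if_box_integrals_0[OF hk box0])
    then have "integral\<^sup>L (lebesgue_on (Q n)) (\<lambda>x. norm (g x)) = 0"
      using lebesgue_integral_eq_integral[OF integrable_norm[OF int], of "- (real n *\<^sub>R One)" "real n *\<^sub>R One"]
      by (simp add: Q_def integral_unique)
    then have "AE x in lebesgue_on (Q n). g x = 0"
      using integral_nonneg_eq_0_iff_AE[OF integrable_norm[OF int]] unfolding Q_def by simp
    then show ?thesis unfolding Q_def by (simp add: AE_restrict_space_iff)
  qed
  then have all: "AE x in lebesgue. \<forall>n. x \<in> Q n \<longrightarrow> g x = 0" by (subst AE_all_countable) blast
  have cover: "\<exists>n. x \<in> Q n" for x
  proof -
    obtain n where "norm x \<le> real n" using real_arch_simple by blast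
    then have "x \<in> Q n"
      unfolding Q_def mem_box using Basis_le_norm[of _ x] by (force simp: abs_le_iff)
    then show ?thesis ..
  qed
  show ?thesis using all by eventually_elim (use cover in blast)
qed

section \<open>Weak gradients\<close>

lemma locally_integrable_diff:
  "locally_integrable f \<Longrightarrow> locally_integrable g \<Longrightarrow> locally_integrable (\<lambda>x. f x - g x)"
  by (simp add: locally_integrable_def)

lemma locally_integrable_inner:
  "locally_integrable G \<Longrightarrow> locally_integrable (\<lambda>x. G x \<bullet> e)"
  by (simp add: locally_integrable_def)

lemma has_weak_gradient_diff:
  fixes u v :: "'a::euclidean_space \<Rightarrow> real"
  assumes u: "has_weak_gradient u G" and v: "has_weak_gradient v H"
  shows "has_weak_gradient (\<lambda>x. u x - v x) (\<lambda>x. G x - H x)"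
  unfolding has_weak_gradient_def
proof (intro conjI allI impI ballI)
  note loc = u[unfolded has_weak_gradient_def] v[unfolded has_weak_gradient_def]
  show "locally_integrable (\<lambda>x. u x - v x)" "locally_integrable (\<lambda>x. G x - H x)"
    using loc by (auto intro: locally_integrable_diff)
  fix \<phi> :: "'a \<Rightarrow> real" and e :: 'a assume \<phi>: "test_function \<phi>" and e: "e \<in> Basis"
  have "(\<integral>x. (u x - v x) * frechet_derivative \<phi> (at x) e \<partial>lebesgue)
      = (\<integral>x. u x * frechet_derivative \<phi> (at x) e \<partial>lebesgue) - (\<integral>x. v x * frechet_derivative \<phi> (at x) e \<partial>lebesgue)"
    unfolding left_diff_distrib
    using loc \<phi> by (intro Bochner_Integration.integral_diff integrable_mult_test_function) auto
  also have "\<dots> = - ((\<integral>x. (G x \<bullet> e) * \<phi> x \<partial>lebesgue) - (\<integral>x. (H x \<bullet> e) * \<phi> x \<partial>lebesgue))"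
    using loc \<phi> e by auto
  also have "(\<integral>x. (G x \<bullet> e) * \<phi> x \<partial>lebesgue) - (\<integral>x. (H x \<bullet> e) * \<phi> x \<partial>lebesgue)
      = (\<integral>x. ((G x - H x) \<bullet> e) * \<phi> x \<partial>lebesgue)"
    unfolding inner_diff_left left_diff_distrib
    using loc \<phi>
    by (intro Bochner_Integration.integral_diff[symmetric] integrable_mult_test_function locally_integrable_inner) auto
  finally show "(\<integral>x. (u x - v x) * frechet_derivative \<phi> (at x) e \<partial>lebesgue)
      = - (\<integral>x. ((G x - H x) \<bullet> e) * \<phi> x \<partial>lebesgue)" .
qed

text \<open>The difference of two weak gradients of \<open>u\<close> is a weak gradient of \<open>0\<close>, so each of its components is
orthogonal to all test functions.\<close>

lemma has_weak_gradient_unique: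
  fixes u :: "'a::euclidean_space \<Rightarrow> real"
  assumes "has_weak_gradient u G" "has_weak_gradient u H"
  shows "AE x in lebesgue. G x = H x"
proof -
  have D: "has_weak_gradient (\<lambda>x. u x - u x) (\<lambda>x. G x - H x)"
    using assms by (rule has_weak_gradient_diff)
  have "AE x in lebesgue. (G x - H x) \<bullet> e = 0" if "e \<in> Basis" for e
    using D that unfolding has_weak_gradient_def
    by (intro fundamental_lemma_calculus_of_variations locally_integrable_inner) auto
  then have "AE x in lebesgue. \<forall>e\<in>Basis. (G x - H x) \<bullet> e = 0"
    by (intro AE_finite_allI) auto
  then show ?thesis
    by eventually_elim (rule euclidean_eqI, simp add: inner_diff_left)
qed

lemma weak_gradient_works:
  "has_weak_gradient u G \<Longrightarrow> has_weak_gradient u (weak_gradient u)"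
  unfolding weak_gradient_def using someI[of "has_weak_gradient u" G] .

lemma weak_gradient_eq_AE:
  fixes u :: "'a::euclidean_space \<Rightarrow> real"
  assumes "has_weak_gradient u G"
  shows "AE x in lebesgue. weak_gradient u x = G x"
  using weak_gradient_works[OF assms] assms by (rule has_weak_gradient_unique)

text \<open>The weak gradient is an arbitrary choice among all candidates, so its linearity is not automatic:
it holds only almost everywhere, by uniqueness.\<close>

lemma weak_gradient_diff_AE:
  fixes u v :: "'a::euclidean_space \<Rightarrow> real"
  assumes "has_weak_gradient u G" "has_weak_gradient v H"
  shows "AE x in lebesgue. weak_gradient (\<lambda>x. u x - v x) x = weak_gradient u x - weak_gradient v x"
  by (rule weak_gradient_eq_AE[OF has_weak_gradient_diff[OF weak_gradient_works[OF assms(1)] weak_gradient_works[OF assms(2)]]])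

section \<open>The period cell\<close>

text \<open>In coordinates with respect to the basis of periods the cell is the open unit cube. This gives
openness, hence measurability.\<close>

lemma period_cell_representation:
  fixes B :: "'a::euclidean_space set"
  assumes B: "independent B" "span B = UNIV"
  shows "period_cell a B = {x. \<forall>b\<in>B. 0 < representation B (x - a) b \<and> representation B (x - a) b < 1}"
proof (intro set_eqI iffI)
  have fin: "finite B" using B(1) by (rule independent_imp_finite)
  fix x
  assume "x \<in> period_cell a B"
  then obtain s where s: "x = a + (\<Sum>b\<in>B. s b *\<^sub>R b)" "\<forall>b\<in>B. 0 < s b \<and> s b < 1"
    by (auto simp: period_cell_def)
  let ?f = "\<lambda>b. if b \<in> B then s b else 0"
  have sub: "{b. ?f b \<noteq> 0} \<subseteq> B" by auto
  have "(\<Sum>b | ?f b \<noteq> 0. ?f b *\<^sub>R b) = (\<Sum>b\<in>B. s b *\<^sub>R b)"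
    by (rule sum.mono_neutral_cong_left[OF fin sub]) auto
  then have "representation B (x - a) = ?f"
    using B s(1) by (intro representation_eqI finite_subset[OF sub fin]) (auto split: if_splits)
  then show "x \<in> {x. \<forall>b\<in>B. 0 < representation B (x - a) b \<and> representation B (x - a) b < 1}"
    using s(2) by simp
next
  have fin: "finite B" using B(1) by (rule independent_imp_finite)
  fix x
  assume "x \<in> {x. \<forall>b\<in>B. 0 < representation B (x - a) b \<and> representation B (x - a) b < 1}"
  moreover have "x = a + (\<Sum>b\<in>B. representation B (x - a) b *\<^sub>R b)"
    using sum_representation_eq[OF B(1) _ fin subset_refl, of "x - a"] B(2) by simp
  ultimately show "x \<in> period_cell a B" unfolding period_cell_def by blast
qed

lemma open_period_cell:
  fixes B :: "'a::euclidean_space set"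
  assumes B: "independent B" "span B = UNIV"
  shows "open (period_cell a B)"
proof -
  have fin: "finite B" using B(1) by (rule independent_imp_finite)
  have "linear (\<lambda>x. representation B x b)" for b
    using B by (intro linearI) (simp_all add: representation_add representation_scale)
  then have "bounded_linear (\<lambda>x. representation B x b)" for b
    by (simp only: linear_conv_bounded_linear)
  then have cont: "continuous_on UNIV (\<lambda>x. representation B (x - a) b)" for b
    by (rule bounded_linear.continuous_on) (intro continuous_intros)
  have "open {x. 0 < representation B (x - a) b \<and> representation B (x - a) b < 1}" for b
    by (intro open_Collect_conj open_Collect_less cont continuous_on_const)
  then have "open (\<Inter>b\<in>B. {x. 0 < representation B (x - a) b \<and> representation B (x - a) b < 1})"
    using fin by (intro open_INT) auto
  also have "(\<Inter>b\<in>B. {x. 0 < representation B (x - a) b \<and> representation B (x - a) b < 1}) = period_cell a B"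
    unfolding period_cell_representation[OF B] by auto
  finally show ?thesis .
qed

lemma bounded_period_cell: "bounded (period_cell a B)"
proof -
  have "norm x \<le> norm a + (\<Sum>b\<in>B. norm b)" if x: "x \<in> period_cell a B" for x
  proof -
    obtain s where s: "x = a + (\<Sum>b\<in>B. s b *\<^sub>R b)" "\<forall>b\<in>B. 0 < s b \<and> s b < 1"
      using x by (auto simp: period_cell_def)
    have "norm (\<Sum>b\<in>B. s b *\<^sub>R b) \<le> (\<Sum>b\<in>B. norm b)"
    proof (rule order_trans[OF norm_sum sum_mono])
      fix b assume "b \<in> B"
      then have "\<bar>s b\<bar> \<le> 1" using s(2) by force
      then show "norm (s b *\<^sub>R b) \<le> norm b" by (simp add: mult_left_le_one_le)
    qed
    then show ?thesis unfolding s(1) using norm_triangle_ineq order_trans add_left_mono by metis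
  qed
  then show ?thesis by (auto simp: bounded_iff)
qed

section \<open>The function space\<close>

lemma power_norm_diff_le:
  fixes x y :: "'a::real_normed_vector"
  shows "norm (x - y) ^ p \<le> 2 ^ p * (norm x ^ p + norm y ^ p)"
proof -
  have "norm (x - y) \<le> 2 * max (norm x) (norm y)"
    using norm_triangle_ineq4[of x y] by linarith
  then have "norm (x - y) ^ p \<le> (2 * max (norm x) (norm y)) ^ p"
    by (rule power_mono) simp
  also have "\<dots> = 2 ^ p * max (norm x) (norm y) ^ p" by (rule power_mult_distrib)
  also have "max (norm x) (norm y) ^ p \<le> norm x ^ p + norm y ^ p" by (simp add: max_def)
  finally show ?thesis by simp
qed

lemma Lp_on_diff:
  assumes f: "f \<in> Lp_on p \<Omega>" and g: "g \<in> Lp_on p \<Omega>"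
  shows "(\<lambda>x. f x - g x) \<in> Lp_on p \<Omega>"
proof -
  have m: "f \<in> borel_measurable (lebesgue_on \<Omega>)" "g \<in> borel_measurable (lebesgue_on \<Omega>)"
    using f g by (auto simp: Lp_on_def)
  have "integrable (lebesgue_on \<Omega>) (\<lambda>x. norm (f x - g x) ^ p)"
  proof (rule Bochner_Integration.integrable_bound)
    show "integrable (lebesgue_on \<Omega>) (\<lambda>x. 2 ^ p * (norm (f x) ^ p + norm (g x) ^ p))"
      using f g by (auto simp: Lp_on_def)
    show "(\<lambda>x. norm (f x - g x) ^ p) \<in> borel_measurable (lebesgue_on \<Omega>)"
      using m by measurable
    show "AE x in lebesgue_on \<Omega>. norm (norm (f x - g x) ^ p) \<le> norm (2 ^ p * (norm (f x) ^ p + norm (g x) ^ p))"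
      using power_norm_diff_le by (intro AE_I2) (simp add: abs_of_nonneg)
  qed
  then show ?thesis using m by (simp add: Lp_on_def)
qed

lemma V_space_diff:
  assumes "u \<in> V_space a B" "v \<in> V_space a B"
  shows "(\<lambda>x. u x - v x) \<in> V_space a B"
  using assms unfolding V_space_def H1_periodic_def periodic_def
  by (auto intro!: Lp_on_diff) (blast intro: has_weak_gradient_diff Lp_on_diff)

lemma Lp_on_const:
  assumes "\<Omega> \<in> lmeasurable"
  shows "(\<lambda>x. c) \<in> Lp_on p \<Omega>"
  using finite_measure.integrable_const[OF finite_measure_lebesgue_on[OF assms]]
  by (simp add: Lp_on_def)

lemma abs_mult4_le:
  fixes a b c d :: real
  shows "\<bar>a * b * c * d\<bar> \<le> a^4 + b^4 + c^4 + d^4"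
proof -
  have amgm: "\<bar>x * y\<bar> \<le> (x\<^sup>2 + y\<^sup>2) / 2" for x y :: real
    using sum_squares_bound[of "\<bar>x\<bar>" "\<bar>y\<bar>"] by (simp add: abs_mult)
  have "\<bar>(a * b) * (c * d)\<bar> \<le> ((a * b)\<^sup>2 + (c * d)\<^sup>2) / 2" by (rule amgm)
  also have "(a * b)\<^sup>2 \<le> (a^4 + b^4) / 2"
    using amgm[of "a\<^sup>2" "b\<^sup>2"] by (simp add: power_mult_distrib flip: power_mult)
  also have "(c * d)\<^sup>2 \<le> (c^4 + d^4) / 2"
    using amgm[of "c\<^sup>2" "d\<^sup>2"] by (simp add: power_mult_distrib flip: power_mult)
  finally have "\<bar>(a * b) * (c * d)\<bar> \<le> ((a^4 + b^4) / 2 + (c^4 + d^4) / 2) / 2" by simp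
  then have "\<bar>a * b * c * d\<bar> \<le> ((a^4 + b^4) / 2 + (c^4 + d^4) / 2) / 2"
    by (simp only: mult.assoc)
  moreover have "((A + B) / 2 + (C + D) / 2) / 2 \<le> A + B + C + D"
    if "0 \<le> A" "0 \<le> B" "0 \<le> C" "0 \<le> D" for A B C D :: real
    using that by (simp add: field_simps)
  ultimately show ?thesis by (meson order_trans zero_le_even_power even_numeral)
qed

text \<open>On a cell of finite measure the constants lie in \<open>L\<^sup>4\<close>, so this one fact covers every integral of a
polynomial of degree at most four in the solution.\<close>

lemma integrable_mult4:
  fixes f1 f2 f3 f4 :: "'a::euclidean_space \<Rightarrow> real"
  assumes "f1 \<in> Lp_on 4 \<Omega>" "f2 \<in> Lp_on 4 \<Omega>" "f3 \<in> Lp_on 4 \<Omega>" "f4 \<in> Lp_on 4 \<Omega>"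
  shows "integrable (lebesgue_on \<Omega>) (\<lambda>x. f1 x * f2 x * f3 x * f4 x)"
proof (rule Bochner_Integration.integrable_bound)
  have int: "integrable (lebesgue_on \<Omega>) (\<lambda>x. f x ^ 4)" if "f \<in> Lp_on 4 \<Omega>" for f :: "'a \<Rightarrow> real"
    using that by (simp add: Lp_on_def)
  show "integrable (lebesgue_on \<Omega>) (\<lambda>x. f1 x ^ 4 + f2 x ^ 4 + f3 x ^ 4 + f4 x ^ 4)"
    using assms by (intro Bochner_Integration.integrable_add int)
  show "(\<lambda>x. f1 x * f2 x * f3 x * f4 x) \<in> borel_measurable (lebesgue_on \<Omega>)"
    using assms by (intro borel_measurable_times) (auto simp: Lp_on_def)
  show "AE x in lebesgue_on \<Omega>. norm (f1 x * f2 x * f3 x * f4 x) \<le> norm (f1 x ^ 4 + f2 x ^ 4 + f3 x ^ 4 + f4 x ^ 4)"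
    unfolding real_norm_def by (intro AE_I2 order_trans[OF abs_mult4_le abs_ge_self])
qed

lemma integrable_mult2:
  fixes f g :: "'a::euclidean_space \<Rightarrow> real"
  assumes "\<Omega> \<in> lmeasurable" "f \<in> Lp_on 4 \<Omega>" "g \<in> Lp_on 4 \<Omega>"
  shows "integrable (lebesgue_on \<Omega>) (\<lambda>x. f x * g x)"
  using integrable_mult4[OF assms(2,3) Lp_on_const[OF assms(1)] Lp_on_const[OF assms(1)], of 1 1] by simp

lemma integrable_inner_Lp2:
  fixes F G :: "'a::euclidean_space \<Rightarrow> 'b::euclidean_space"
  assumes "F \<in> Lp_on 2 \<Omega>" "G \<in> Lp_on 2 \<Omega>"
  shows "integrable (lebesgue_on \<Omega>) (\<lambda>x. F x \<bullet> G x)"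
proof (rule Bochner_Integration.integrable_bound)
  show "integrable (lebesgue_on \<Omega>) (\<lambda>x. norm (F x) ^ 2 + norm (G x) ^ 2)"
    using assms by (simp add: Lp_on_def)
  show "(\<lambda>x. F x \<bullet> G x) \<in> borel_measurable (lebesgue_on \<Omega>)"
    using assms by (intro borel_measurable_inner) (auto simp: Lp_on_def)
  have "\<bar>v \<bullet> w\<bar> \<le> norm v ^ 2 + norm w ^ 2" for v w :: 'b
    using Cauchy_Schwarz_ineq2[of v w] sum_squares_bound[of "norm v" "norm w"]
      mult_nonneg_nonneg[OF norm_ge_zero[of v] norm_ge_zero[of w]] by linarith
  then show "AE x in lebesgue_on \<Omega>. norm (F x \<bullet> G x) \<le> norm (norm (F x) ^ 2 + norm (G x) ^ 2)"
    by (intro AE_I2) simp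
qed

text \<open>Some weak gradient of \<open>u\<close> is square integrable, and the selected one agrees with it almost everywhere.\<close>

lemma weak_gradient_Lp2:
  fixes u :: "'a::euclidean_space \<Rightarrow> real"
  assumes B: "independent B" "span B = UNIV" and u: "u \<in> H1_periodic a B"
  shows "weak_gradient u \<in> Lp_on 2 (period_cell a B)"
proof -
  let ?\<Omega> = "period_cell a B"
  obtain G where G: "has_weak_gradient u G" "G \<in> Lp_on 2 ?\<Omega>" using u by (auto simp: H1_periodic_def)
  have \<Omega>: "?\<Omega> \<in> sets lebesgue" using open_period_cell[OF B] by auto
  have "compact (closure ?\<Omega>)" using bounded_period_cell by (simp add: compact_closure)
  then have "integrable (lebesgue_on (closure ?\<Omega>)) (weak_gradient u)"
    using weak_gradient_works[OF G(1)] by (simp add: has_weak_gradient_def locally_integrable_def)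
  then have m: "weak_gradient u \<in> borel_measurable (lebesgue_on ?\<Omega>)"
    by (intro borel_measurable_integrable integrable_lebesgue_on_subset[OF _ _ \<Omega> closure_subset]) auto
  have mG: "G \<in> borel_measurable (lebesgue_on ?\<Omega>)" using G(2) by (simp add: Lp_on_def)
  have "AE x in lebesgue_on ?\<Omega>. norm (weak_gradient u x) ^ 2 = norm (G x) ^ 2"
    using weak_gradient_eq_AE[OF G(1)] \<Omega> by (auto simp: AE_restrict_space_iff elim: eventually_mono)
  then have "integrable (lebesgue_on ?\<Omega>) (\<lambda>x. norm (weak_gradient u x) ^ 2) \<longleftrightarrow>
      integrable (lebesgue_on ?\<Omega>) (\<lambda>x. norm (G x) ^ 2)"
  proof (rule integrable_cong_AE[rotated 2])
    show "(\<lambda>x. norm (weak_gradient u x) ^ 2) \<in> borel_measurable (lebesgue_on ?\<Omega>)" using m by measurable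
    show "(\<lambda>x. norm (G x) ^ 2) \<in> borel_measurable (lebesgue_on ?\<Omega>)" using mG by measurable
  qed
  then show ?thesis using G(2) m by (simp add: Lp_on_def)
qed

section \<open>Energy dissipation\<close>

text \<open>Taylor's formula for the double well, whose second derivative \<open>3 z\<^sup>2 - 1\<close> is at least \<open>-1\<close>. The
concave part costs \<open>(z - y)\<^sup>2 / 2\<close>.\<close>

lemma double_well_convexity:
  fixes y z :: real
  shows "1/4 * (z\<^sup>2 - 1)\<^sup>2 - 1/4 * (y\<^sup>2 - 1)\<^sup>2 \<le> f_AC z * (z - y) + 1/2 * (z - y)\<^sup>2"
proof -
  have "f_AC z * (z - y) + 1/2 * (z - y)\<^sup>2 - (1/4 * (z\<^sup>2 - 1)\<^sup>2 - 1/4 * (y\<^sup>2 - 1)\<^sup>2)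
      = (z - y)\<^sup>2 * ((z + y)\<^sup>2 + 2 * z\<^sup>2) / 4"
    unfolding f_AC_def by (simp add: field_simps power2_eq_square power3_eq_cube)
  also have "\<dots> \<ge> 0" by simp
  finally show ?thesis by simp
qed

lemma L2_norm_power2: "(L2_norm \<Omega> f)\<^sup>2 = L2_inner \<Omega> f f"
  by (simp add: L2_norm_def L2_inner_def)

text \<open>The increment of the energy against the weak form tested with \<open>v = u - w\<close>. The gradient part rests on
\<open>\<parallel>p\<parallel>\<^sup>2 - \<parallel>q\<parallel>\<^sup>2 \<le> 2 p \<bullet> (p - q)\<close>, which needs the weak gradient of \<open>v\<close> to be the difference of the weak
gradients of \<open>u\<close> and \<open>w\<close>.\<close>

lemma energy_diff_le:
  fixes u w :: "'a::euclidean_space \<Rightarrow> real"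
  assumes B: "independent B" "span B = UNIV" and u: "u \<in> V_space a B" and w: "w \<in> V_space a B"
  defines "\<Omega> \<equiv> period_cell a B" and "v \<equiv> \<lambda>x. u x - w x"
  shows "energy \<epsilon> \<Omega> u - energy \<epsilon> \<Omega> w
    \<le> \<epsilon>\<^sup>2 * L2_inner \<Omega> (weak_gradient u) (weak_gradient v)
      + L2_inner \<Omega> (\<lambda>x. f_AC (u x)) v + 1/2 * L2_inner \<Omega> v v"
proof -
  let ?M = "lebesgue_on \<Omega>"
  have \<Omega>: "\<Omega> \<in> sets lebesgue" "\<Omega> \<in> lmeasurable"
    using open_period_cell[OF B] bounded_period_cell
    by (auto simp: \<Omega>_def intro!: bounded_set_imp_lmeasurable)
  have v: "v \<in> V_space a B" unfolding v_def using u w by (rule V_space_diff)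
  have grad: "weak_gradient f \<in> Lp_on 2 \<Omega>" if "f \<in> V_space a B" for f
    unfolding \<Omega>_def using that by (intro weak_gradient_Lp2[OF B]) (auto simp: V_space_def)
  obtain G H where "has_weak_gradient u G" "has_weak_gradient w H"
    using u w by (auto simp: V_space_def H1_periodic_def)
  from weak_gradient_diff_AE[OF this]
  have "AE x in ?M. weak_gradient u x \<bullet> weak_gradient v x = weak_gradient u x \<bullet> (weak_gradient u x - weak_gradient w x)"
    using \<Omega>(1) unfolding v_def by (auto simp: AE_restrict_space_iff elim: eventually_mono)
  then have inner_v: "L2_inner \<Omega> (weak_gradient u) (weak_gradient v)
      = (\<integral>x. weak_gradient u x \<bullet> (weak_gradient u x - weak_gradient w x) \<partial>?M)"
    unfolding L2_inner_def
    using grad[OF u] grad[OF v] grad[OF w]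
    by (intro integral_cong_AE borel_measurable_inner borel_measurable_diff) (auto simp: Lp_on_def)
  have "L2_inner \<Omega> (weak_gradient u) (weak_gradient u) - L2_inner \<Omega> (weak_gradient w) (weak_gradient w)
      = (\<integral>x. weak_gradient u x \<bullet> weak_gradient u x - weak_gradient w x \<bullet> weak_gradient w x \<partial>?M)"
    unfolding L2_inner_def
    by (intro Bochner_Integration.integral_diff[symmetric] integrable_inner_Lp2 grad u w)
  also have "\<dots> \<le> (\<integral>x. 2 * (weak_gradient u x \<bullet> (weak_gradient u x - weak_gradient w x)) \<partial>?M)"
  proof (rule integral_mono)
    show "integrable ?M (\<lambda>x. weak_gradient u x \<bullet> weak_gradient u x - weak_gradient w x \<bullet> weak_gradient w x)"
      by (intro Bochner_Integration.integrable_diff integrable_inner_Lp2 grad u w)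
    show "integrable ?M (\<lambda>x. 2 * (weak_gradient u x \<bullet> (weak_gradient u x - weak_gradient w x)))"
      by (intro integrable_mult_right integrable_inner_Lp2 Lp_on_diff grad u w)
    show "weak_gradient u x \<bullet> weak_gradient u x - weak_gradient w x \<bullet> weak_gradient w x
        \<le> 2 * (weak_gradient u x \<bullet> (weak_gradient u x - weak_gradient w x))" for x
      using inner_ge_zero[of "weak_gradient u x - weak_gradient w x"]
      by (simp add: inner_diff_left inner_diff_right inner_commute)
  qed
  also have "\<dots> = 2 * L2_inner \<Omega> (weak_gradient u) (weak_gradient v)"
    unfolding inner_v by simp
  finally have "\<epsilon>\<^sup>2 / 2 * (L2_inner \<Omega> (weak_gradient u) (weak_gradient u) - L2_inner \<Omega> (weak_gradient w) (weak_gradient w))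
      \<le> \<epsilon>\<^sup>2 / 2 * (2 * L2_inner \<Omega> (weak_gradient u) (weak_gradient v))"
    by (rule mult_left_mono) simp
  then have gradient_part: "\<epsilon>\<^sup>2 / 2 * L2_inner \<Omega> (weak_gradient u) (weak_gradient u)
      - \<epsilon>\<^sup>2 / 2 * L2_inner \<Omega> (weak_gradient w) (weak_gradient w)
      \<le> \<epsilon>\<^sup>2 * L2_inner \<Omega> (weak_gradient u) (weak_gradient v)"
    by (simp add: algebra_simps)
  have L4: "u \<in> Lp_on 4 \<Omega>" "w \<in> Lp_on 4 \<Omega>" "v \<in> Lp_on 4 \<Omega>" "(\<lambda>_. 1) \<in> Lp_on 4 \<Omega>"
    using u w v Lp_on_const[OF \<Omega>(2)] by (auto simp: V_space_def \<Omega>_def)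
  have well: "integrable ?M (\<lambda>x. (f x)\<^sup>2 - 1) \<and> integrable ?M (\<lambda>x. ((f x)\<^sup>2 - 1) * ((f x)\<^sup>2 - 1))"
    if f: "f \<in> Lp_on 4 \<Omega>" for f :: "'a \<Rightarrow> real"
  proof -
    have "integrable ?M (\<lambda>x. f x * f x * f x * f x - 2 * (f x * f x * 1 * 1) + 1 * 1 * 1 * 1)"
      by (intro Bochner_Integration.integrable_add Bochner_Integration.integrable_diff integrable_mult_right integrable_mult4 f L4)
    moreover have "integrable ?M (\<lambda>x. f x * f x * 1 * 1 - 1 * 1 * 1 * 1)"
      by (intro Bochner_Integration.integrable_diff integrable_mult4 f L4)
    ultimately show ?thesis by (simp add: power2_eq_square algebra_simps)
  qed
  have fv: "integrable ?M (\<lambda>x. f_AC (u x) * v x)"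
  proof -
    have "integrable ?M (\<lambda>x. u x * u x * u x * v x - u x * v x * 1 * 1)"
      by (intro Bochner_Integration.integrable_diff integrable_mult4 L4)
    then show ?thesis by (simp add: f_AC_def power3_eq_cube algebra_simps)
  qed
  have vv: "integrable ?M (\<lambda>x. v x * v x)" by (rule integrable_mult2[OF \<Omega>(2) L4(3,3)])
  have "1/4 * L2_inner \<Omega> (\<lambda>x. (u x)\<^sup>2 - 1) (\<lambda>x. (u x)\<^sup>2 - 1) - 1/4 * L2_inner \<Omega> (\<lambda>x. (w x)\<^sup>2 - 1) (\<lambda>x. (w x)\<^sup>2 - 1)
      = (\<integral>x. 1/4 * (((u x)\<^sup>2 - 1) * ((u x)\<^sup>2 - 1)) - 1/4 * (((w x)\<^sup>2 - 1) * ((w x)\<^sup>2 - 1)) \<partial>?M)"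
    using well[OF L4(1)] well[OF L4(2)] by (simp add: L2_inner_def)
  also have "\<dots> \<le> (\<integral>x. f_AC (u x) * v x + 1/2 * (v x * v x) \<partial>?M)"
  proof (rule integral_mono)
    show "integrable ?M (\<lambda>x. 1/4 * (((u x)\<^sup>2 - 1) * ((u x)\<^sup>2 - 1)) - 1/4 * (((w x)\<^sup>2 - 1) * ((w x)\<^sup>2 - 1)))"
      using well[OF L4(1)] well[OF L4(2)] by simp
    show "integrable ?M (\<lambda>x. f_AC (u x) * v x + 1/2 * (v x * v x))" using fv vv by simp
    show "1/4 * (((u x)\<^sup>2 - 1) * ((u x)\<^sup>2 - 1)) - 1/4 * (((w x)\<^sup>2 - 1) * ((w x)\<^sup>2 - 1))
        \<le> f_AC (u x) * v x + 1/2 * (v x * v x)" for x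
      using double_well_convexity[of "u x" "w x"] unfolding v_def power2_eq_square by simp
  qed
  also have "\<dots> = L2_inner \<Omega> (\<lambda>x. f_AC (u x)) v + 1/2 * L2_inner \<Omega> v v"
    using fv vv by (simp add: L2_inner_def)
  finally show ?thesis
    using gradient_part by (simp add: energy_def L2_norm_power2)
qed

text \<open>The energy plus half the integrated storage does not increase from one step to the next. The
concave part of the double well contributes \<open>\<parallel>\<nabla>\<^sub>\<tau>u\<^sup>n\<parallel>\<^sup>2 / 2\<close>; the kernels provide
\<open>\<parallel>\<nabla>\<^sub>\<tau>u\<^sup>n\<parallel>\<^sup>2 / (5 \<tau>\<^sub>n)\<close>, which absorbs it when \<open>\<tau>\<^sub>n \<le> 2/5\<close>.\<close>

lemma bdf3_modified_energy_le:
  fixes a :: "'a::euclidean_space" and u :: "nat \<Rightarrow> 'a \<Rightarrow> real"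
  assumes B: "independent B" "span B = UNIV"
    and tau_pos: "\<And>k. 1 \<le> k \<Longrightarrow> k \<le> N \<Longrightarrow> 0 < tau t k"
    and tau_le: "\<And>k. 1 \<le> k \<Longrightarrow> k \<le> N \<Longrightarrow> tau t k \<le> 2/5"
    and ratio_le: "\<And>k. 2 \<le> k \<Longrightarrow> k \<le> N \<Longrightarrow> ratio t k \<le> 3/2"
    and sol: "bdf3_solution \<epsilon> a B t N u0 u"
  shows "n \<le> N \<Longrightarrow> energy \<epsilon> (period_cell a B) (u n)
      + 1/2 * (\<integral>x. bdf3_storage t u n x \<partial>lebesgue_on (period_cell a B)) \<le> energy \<epsilon> (period_cell a B) (u 0)"
proof (induction n)
  case 0
  show ?case by (simp add: bdf3_storage_def tau_def)
next
  case (Suc n)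
  define \<Omega> where "\<Omega> = period_cell a B"
  let ?M = "lebesgue_on \<Omega>" and ?v = "\<lambda>x. u (Suc n) x - u n x"
  have \<Omega>: "\<Omega> \<in> lmeasurable"
    using open_period_cell[OF B] bounded_period_cell
    by (auto simp: \<Omega>_def intro!: bounded_set_imp_lmeasurable)
  have V: "u k \<in> V_space a B" if "k \<le> N" for k
    using sol that by (simp add: bdf3_solution_def Let_def)
  have L4: "u k \<in> Lp_on 4 \<Omega>" if "k \<le> N" for k
    using V[OF that] by (simp add: V_space_def \<Omega>_def)
  have incr: "(\<lambda>x. u k x - u l x) \<in> Lp_on 4 \<Omega>" if "k \<le> N" "l \<le> N" for k l
    using that by (intro Lp_on_diff L4)
  have prod: "integrable ?M (\<lambda>x. (u k x - u l x) * (u i x - u j x))"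
    if "k \<le> N" "l \<le> N" "i \<le> N" "j \<le> N" for i j k l
    using that by (intro integrable_mult2[OF \<Omega>] incr)
  have stor: "integrable ?M (bdf3_storage t u k)" if "k \<le> N" for k
  proof -
    have "integrable ?M (\<lambda>x. 8/5 / tau t k * ((u k x - u (k - 1) x) * (u k x - u (k - 1) x))
        - 4/5 * (ratio t k)\<^sup>2 / tau t k * ((u k x - u (k - 1) x) * (u (k - 1) x - u (k - 2) x))
        + 3/5 / tau t (k - 1) * ((u (k - 1) x - u (k - 2) x) * (u (k - 1) x - u (k - 2) x)))"
      using that by (intro Bochner_Integration.integrable_add Bochner_Integration.integrable_diff integrable_mult_right prod) auto
    also have "(\<lambda>x. 8/5 / tau t k * ((u k x - u (k - 1) x) * (u k x - u (k - 1) x))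
        - 4/5 * (ratio t k)\<^sup>2 / tau t k * ((u k x - u (k - 1) x) * (u (k - 1) x - u (k - 2) x))
        + 3/5 / tau t (k - 1) * ((u (k - 1) x - u (k - 2) x) * (u (k - 1) x - u (k - 2) x))) = bdf3_storage t u k"
      unfolding bdf3_storage_def power2_eq_square
      by (simp add: fun_eq_iff diff_divide_distrib mult.assoc)
    finally show ?thesis .
  qed
  have vv: "integrable ?M (\<lambda>x. ?v x * ?v x)" using Suc.prems by (intro prod) auto
  have Dv: "integrable ?M (\<lambda>x. D3 t u (Suc n) x * ?v x)"
    unfolding D3_def sum_distrib_right mult.assoc using Suc.prems
    by (intro Bochner_Integration.integrable_sum integrable_mult_right prod) auto
  \<comment> \<open>The dissipation inequality is applied to the real numbers \<open>u k x\<close> at each point \<open>x\<close>; it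
    survives integration because it is linear in the storage and in the products of increments.\<close>
  have pointwise: "1/2 * bdf3_storage t u (Suc n) x - 1/2 * bdf3_storage t u n x + 1/2 * (?v x * ?v x)
      \<le> D3 t u (Suc n) x * ?v x" for x
  proof -
    have tau: "0 < tau t (Suc n)" "tau t (Suc n) \<le> 2/5" using Suc.prems tau_pos tau_le by auto
    have "bdf3_storage t u (Suc n) x - bdf3_storage t u n x + 2/5 * (?v x)\<^sup>2 / tau t (Suc n)
        \<le> 2 * ?v x * D3 t u (Suc n) x"
      using D3_dissipation[of "Suc n" t u x] Suc.prems tau_pos ratio_le by simp
    moreover have "(?v x)\<^sup>2 \<le> 2/5 * (?v x)\<^sup>2 / tau t (Suc n)"
    proof -
      have "(?v x)\<^sup>2 * tau t (Suc n) \<le> (?v x)\<^sup>2 * (2/5)" using tau(2) by (rule mult_left_mono) simp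
      then show ?thesis using tau(1) by (simp add: pos_le_divide_eq)
    qed
    ultimately show ?thesis by (simp add: power2_eq_square algebra_simps)
  qed
  have "1/2 * (\<integral>x. bdf3_storage t u (Suc n) x \<partial>?M) - 1/2 * (\<integral>x. bdf3_storage t u n x \<partial>?M) + 1/2 * L2_inner \<Omega> ?v ?v
      = (\<integral>x. 1/2 * bdf3_storage t u (Suc n) x - 1/2 * bdf3_storage t u n x + 1/2 * (?v x * ?v x) \<partial>?M)"
    using stor[of "Suc n"] stor[of n] vv Suc.prems by (simp add: L2_inner_def)
  also have "\<dots> \<le> (\<integral>x. D3 t u (Suc n) x * ?v x \<partial>?M)"
    using stor[of "Suc n"] stor[of n] vv Dv Suc.prems pointwise by (intro integral_mono) simp_all
  also have "\<dots> = L2_inner \<Omega> (D3 t u (Suc n)) ?v" by (simp add: L2_inner_def)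
  finally have D3: "1/2 * (\<integral>x. bdf3_storage t u (Suc n) x \<partial>?M) - 1/2 * (\<integral>x. bdf3_storage t u n x \<partial>?M)
      + 1/2 * L2_inner \<Omega> ?v ?v \<le> L2_inner \<Omega> (D3 t u (Suc n)) ?v" .
  have "?v \<in> V_space a B" using Suc.prems by (intro V_space_diff V) auto
  then have "L2_inner \<Omega> (D3 t u (Suc n)) ?v
      + \<epsilon>\<^sup>2 * L2_inner \<Omega> (weak_gradient (u (Suc n))) (weak_gradient ?v)
      + L2_inner \<Omega> (\<lambda>x. f_AC (u (Suc n) x)) ?v = 0"
    using sol Suc.prems unfolding bdf3_solution_def Let_def \<Omega>_def by auto
  moreover have "energy \<epsilon> \<Omega> (u (Suc n)) - energy \<epsilon> \<Omega> (u n)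
      \<le> \<epsilon>\<^sup>2 * L2_inner \<Omega> (weak_gradient (u (Suc n))) (weak_gradient ?v)
        + L2_inner \<Omega> (\<lambda>x. f_AC (u (Suc n) x)) ?v + 1/2 * L2_inner \<Omega> ?v ?v"
    unfolding \<Omega>_def using Suc.prems by (intro energy_diff_le[OF B] V) auto
  moreover have "energy \<epsilon> \<Omega> (u n) + 1/2 * (\<integral>x. bdf3_storage t u n x \<partial>?M) \<le> energy \<epsilon> \<Omega> (u 0)"
    using Suc by (simp add: \<Omega>_def)
  ultimately show ?case using D3 unfolding \<Omega>_def[symmetric] by linarith
qed

theorem theorem4p2:
  fixes t :: "nat \<Rightarrow> real" and T \<epsilon> \<gamma> :: real and N :: nat
    and a :: "'a::euclidean_space" and B :: "'a set"
    and u0 :: "'a \<Rightarrow> real" and u :: "nat \<Rightarrow> 'a \<Rightarrow> real"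
  assumes "1 \<le> N" and "t 0 = 0" and "t N = T"
    and "\<And>k. k < N \<Longrightarrow> t k < t (Suc k)"
    and "0 < \<epsilon>"
    and "independent B" and "span B = UNIV"
    and "\<And>n. 2 \<le> n \<Longrightarrow> n \<le> N \<Longrightarrow> ratio t n \<le> 1.405"
    and "\<gamma> = 1 / 200"
    and "\<And>n. 1 \<le> n \<Longrightarrow> n \<le> N \<Longrightarrow>
      tau t n \<le> min
        ((1 + 2 * ratio t n + ratio t (n - 1) * (1 + 4 * ratio t n + 3 * (ratio t n)\<^sup>2))
          / ((1 + ratio t n) * (1 + ratio t (n - 1) + ratio t n * ratio t (n - 1))))
        (2 * \<gamma>)"
    and "u0 \<in> V_space a B"
    and "bdf3_solution \<epsilon> a B t N u0 u"
  shows "\<forall>n. 1 \<le> n \<and> n \<le> N \<longrightarrow>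
    energy \<epsilon> (period_cell a B) (u n) \<le> energy \<epsilon> (period_cell a B) (u 0)"
proof (intro allI impI)
  fix n assume n: "1 \<le> n \<and> n \<le> N"
  have tau_pos: "0 < tau t k" if "1 \<le> k" "k \<le> N" for k
    using assms(4)[of "k - 1"] that by (simp add: tau_def)
  have tau_le: "tau t k \<le> 2/5" if "1 \<le> k" "k \<le> N" for k
    using assms(10)[OF that] assms(9) by simp
  have ratio_le: "ratio t k \<le> 3/2" if "2 \<le> k" "k \<le> N" for k
    using assms(8)[OF that] by simp
  have "0 \<le> (\<integral>x. bdf3_storage t u n x \<partial>lebesgue_on (period_cell a B))"
    using n tau_pos ratio_le by (intro Bochner_Integration.integral_nonneg bdf3_storage_nonneg) auto
  moreover have "energy \<epsilon> (period_cell a B) (u n)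
      + 1/2 * (\<integral>x. bdf3_storage t u n x \<partial>lebesgue_on (period_cell a B)) \<le> energy \<epsilon> (period_cell a B) (u 0)"
    using n by (intro bdf3_modified_energy_le[OF assms(6,7) tau_pos tau_le ratio_le assms(12)]) auto
  ultimately show "energy \<epsilon> (period_cell a B) (u n) \<le> energy \<epsilon> (period_cell a B) (u 0)" by simp
qed

end
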